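(* Let $\mathbf{T}=(T_1,\dots,T_d)$ be a commuting $d$-tuple of bounded operators on $\mathcal{H}$, and let $0<t\le 1$. Then $\sigma_T(\Delta_t(\mathbf{T}))=\sigma_T(\mathbf{T})$. As a consequence, $r(\Delta_t(\mathbf{T}))=r(\mathbf{T})$.
   Context: $\mathcal{H}$ is a complex infinite-dimensional Hilbert space. For a commuting $d$-tuple $\mathbf{T}=(T_1,\dots,T_d)$ of bounded operators on $\mathcal{H}$, put $P:=\sqrt{T_1^*T_1+\cdots+T_d^*T_d}$ and let $T_i=V_iP$ $(i=1,\dots,d)$ be the canonical (spherical) polar decomposition: the column $(V_1,\dots,V_d)^{\mathsf T}:\mathcal{H}\to\mathcal{H}\oplus\cdots\oplus\mathcal{H}$ is the partial isometry in the polar decomposition of the column operator $(T_1,\dots,T_d)^{\mathsf T}$, so that $\bigcap_i\ker T_i=\bigcap_i\ker V_i=\ker P$. For $0\le t\le 1$ the generalized spherical Aluthge transform is $\Delta_t(\mathbf{T}):=(P^tV_1P^{1-t},\dots,P^tV_dP^{1-t})$, with the convention $P^0=I$; it is again a commuting $d$-tuple. Koszul complex $K(\mathbf{T},\mathcal{H})$: the cochain complex $0\to\mathcal{H}\otimes\Lambda^0\to\mathcal{H}\otimes\Lambda^1\to\cdots\to\mathcal{H}\otimes\Lambda^d\to 0$, where $\Lambda^k$ is the $k$-th exterior power of $\mathbb{C}^d$ with basis vectors $e_1,\dots,e_d$, and boundary maps $D^k_{\mathbf{T}}(x\otimes\xi)=\sum_{i=1}^d T_ix\otimes(e_i\wedge\xi)$.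 For $\boldsymbol{\lambda}=(\lambda_1,\dots,\lambda_d)\in\mathbb{C}^d$, $\mathbf{T}-\boldsymbol{\lambda}:=(T_1-\lambda_1,\dots,T_d-\lambda_d)$. The Taylor spectrum $\sigma_T(\mathbf{T})$ is the set of $\boldsymbol{\lambda}\in\mathbb{C}^d$ such that $K(\mathbf{T}-\boldsymbol{\lambda},\mathcal{H})$ is not exact. The joint spectral radius is $r(\mathbf{T}):=\sup\{\sqrt{|\lambda_1|^2+\cdots+|\lambda_d|^2}:(\lambda_1,\dots,\lambda_d)\in\sigma_T(\mathbf{T})\}$. *)

theory Defs
  imports
    "HOL-Analysis.Analysis"
    "HOL-Computational_Algebra.Polynomial"
begin

section \<open>Complex Hilbert spaces\<close>

text \<open>
  The norm, metric and topology are those of the underlying real Banach space. The inner product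
  is linear in the first argument; the last axiom ties it to the norm and makes it positive
  definite.
\<close>

class chilbert_space = banach +
  fixes scaleC :: "complex \<Rightarrow> 'a \<Rightarrow> 'a"  (infixr "*\<^sub>C" 75)
    and cinner :: "'a \<Rightarrow> 'a \<Rightarrow> complex"
  assumes scaleC_add_right: "c *\<^sub>C (x + y) = c *\<^sub>C x + c *\<^sub>C y"
    and scaleC_add_left: "(b + c) *\<^sub>C x = b *\<^sub>C x + c *\<^sub>C x"
    and scaleC_scaleC: "b *\<^sub>C c *\<^sub>C x = (b * c) *\<^sub>C x"
    and scaleC_one: "1 *\<^sub>C x = x"
    and scaleR_scaleC: "r *\<^sub>R x = complex_of_real r *\<^sub>C x"
    and cinner_commute: "cinner x y = cnj (cinner y x)"
    and cinner_add_left: "cinner (x + y) z = cinner x z + cinner y z"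
    and cinner_scaleC_left: "cinner (c *\<^sub>C x) y = c * cinner x y"
    and cinner_self: "cinner x x = complex_of_real ((norm x)\<^sup>2)"

global_interpretation complex_vector:
  vector_space "scaleC :: complex \<Rightarrow> 'a \<Rightarrow> 'a::chilbert_space"
  by unfold_locales (rule scaleC_add_right scaleC_add_left scaleC_scaleC scaleC_one)+


section \<open>Bounded operators\<close>

definition bounded_clinear :: "('a::chilbert_space \<Rightarrow> 'a) \<Rightarrow> bool" where
  "bounded_clinear A \<longleftrightarrow> bounded_linear A \<and> (\<forall>c x. A (c *\<^sub>C x) = c *\<^sub>C A x)"

definition cadjoint :: "('a::chilbert_space \<Rightarrow> 'a) \<Rightarrow> 'a \<Rightarrow> 'a" where
  "cadjoint A = (THE B. bounded_clinear B \<and> (\<forall>x y. cinner (A x) y = cinner x (B y)))"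

definition positive_op :: "('a::chilbert_space \<Rightarrow> 'a) \<Rightarrow> bool" where
  "positive_op A \<longleftrightarrow> bounded_clinear A \<and> (\<forall>x. cinner (A x) x \<in> \<real>\<^sub>\<ge>\<^sub>0)"

definition op_sqrt :: "('a::chilbert_space \<Rightarrow> 'a) \<Rightarrow> 'a \<Rightarrow> 'a" where
  "op_sqrt A = (THE B. positive_op B \<and> B \<circ> B = A)"

definition op_poly :: "real poly \<Rightarrow> ('a::chilbert_space \<Rightarrow> 'a) \<Rightarrow> 'a \<Rightarrow> 'a" where
  "op_poly p A x = (\<Sum>k\<le>degree p. coeff p k *\<^sub>R (A ^^ k) x)"

text \<open>
  Continuous functional calculus for a positive operator \<open>A\<close>, whose spectrum lies in
  \<open>[0, \<parallel>A\<parallel>]\<close>: \<open>f(A)\<close> is the operator-norm limit of \<open>p\<^sub>n(A)\<close> for all polynomials \<open>p\<^sub>n\<close> tending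
  to \<open>f\<close> uniformly on that interval. It is intended for \<open>f\<close> continuous there; such \<open>p\<^sub>n\<close> then exist.
\<close>

definition op_fun :: "(real \<Rightarrow> real) \<Rightarrow> ('a::chilbert_space \<Rightarrow> 'a) \<Rightarrow> 'a \<Rightarrow> 'a" where
  "op_fun f A = (THE B. bounded_clinear B \<and>
     (\<forall>p :: nat \<Rightarrow> real poly.
        uniform_limit {0..onorm A} (\<lambda>n. poly (p n)) f sequentially \<longrightarrow>
        (\<lambda>n. onorm (\<lambda>x. op_poly (p n) A x - B x)) \<longlonglongrightarrow> 0))"

text \<open>
  Powers with exponent \<open>t \<ge> 0\<close> of a positive operator. The case \<open>t = 0\<close> is separate because
  \<open>0 powr 0 = 0\<close>, whereas the convention here is \<open>A\<^sup>0 = I\<close>.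
\<close>

definition op_powr :: "('a::chilbert_space \<Rightarrow> 'a) \<Rightarrow> real \<Rightarrow> 'a \<Rightarrow> 'a" where
  "op_powr A t = (if t = 0 then id else op_fun (\<lambda>s. s powr t) A)"


section \<open>Operator tuples and the spherical Aluthge transform\<close>

text \<open>
  A \<open>d\<close>-tuple is a function on a finite index type \<open>'d\<close> with \<open>d = CARD('d)\<close>; the linear
  order on the index type, used only from the next section on, fixes the signs of exterior products.
\<close>

definition commuting_tuple :: "('d::finite \<Rightarrow> 'a::chilbert_space \<Rightarrow> 'a) \<Rightarrow> bool" where
  "commuting_tuple T \<longleftrightarrow>
     (\<forall>i. bounded_clinear (T i)) \<and> (\<forall>i j. T i \<circ> T j = T j \<circ> T i)"

definition sph_modulus :: "('d::finite \<Rightarrow> 'a::chilbert_space \<Rightarrow> 'a) \<Rightarrow> 'a \<Rightarrow> 'a" where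
  "sph_modulus T = op_sqrt (\<lambda>x. \<Sum>i\<in>UNIV. cadjoint (T i) (T i x))"

text \<open>
  The column \<open>V\<close> is a partial isometry: it preserves norms on the orthogonal complement of its
  kernel \<open>\<Inter>i. ker (V i)\<close>.
\<close>

definition column_partial_isometry :: "('d::finite \<Rightarrow> 'a::chilbert_space \<Rightarrow> 'a) \<Rightarrow> bool" where
  "column_partial_isometry V \<longleftrightarrow>
     (\<forall>i. bounded_clinear (V i)) \<and>
     (\<forall>x. (\<forall>y. (\<forall>i. V i y = 0) \<longrightarrow> cinner x y = 0) \<longrightarrow>
          sqrt (\<Sum>i\<in>UNIV. (norm (V i x))\<^sup>2) = norm x)"

definition sph_polar :: "('d::finite \<Rightarrow> 'a::chilbert_space \<Rightarrow> 'a) \<Rightarrow> 'd \<Rightarrow> 'a \<Rightarrow> 'a" where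
  "sph_polar T = (THE V. column_partial_isometry V \<and>
     (\<forall>i. T i = V i \<circ> sph_modulus T) \<and>
     (\<Inter>i. {x. V i x = 0}) = {x. sph_modulus T x = 0})"

definition sph_aluthge ::
    "real \<Rightarrow> ('d::finite \<Rightarrow> 'a::chilbert_space \<Rightarrow> 'a) \<Rightarrow> 'd \<Rightarrow> 'a \<Rightarrow> 'a" where
  "sph_aluthge t T i =
     op_powr (sph_modulus T) t \<circ> sph_polar T i \<circ> op_powr (sph_modulus T) (1 - t)"


section \<open>Koszul complex and Taylor spectrum\<close>

text \<open>
  An element \<open>\<Sum>I. x\<^sub>I \<otimes> e\<^sub>I\<close> of \<open>H \<otimes> \<Lambda>\<close> is represented by its coefficient family \<open>I \<mapsto> x\<^sub>I\<close>, where
  \<open>I\<close> ranges over the subsets of the index type and \<open>e\<^sub>I\<close> is the exterior product of the \<open>e\<^sub>i\<close>,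
  \<open>i \<in> I\<close>, in increasing order. The summand \<open>H \<otimes> \<Lambda>\<^sup>k\<close> consists of the families supported on the
  sets of cardinality \<open>k\<close>.
\<close>

definition koszul_space :: "nat \<Rightarrow> ('d::finite set \<Rightarrow> 'a::chilbert_space) set" where
  "koszul_space k = {x. \<forall>I. card I \<noteq> k \<longrightarrow> x I = 0}"

text \<open>
  \<open>wedge_coeff i I J\<close> is the coefficient of \<open>e\<^sub>J\<close> in \<open>e\<^sub>i \<and> e\<^sub>I\<close>. The exterior product vanishes if
  \<open>i \<in> I\<close>; otherwise, sorting \<open>e\<^sub>i\<close> into place takes one transposition for each \<open>j \<in> I\<close> below \<open>i\<close>.
\<close>

definition wedge_coeff :: "'d::{finite,linorder} \<Rightarrow> 'd set \<Rightarrow> 'd set \<Rightarrow> real" where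
  "wedge_coeff i I J =
     (if i \<notin> I \<and> J = insert i I then (- 1) ^ card {j \<in> I. j < i} else 0)"

text \<open>
  The linear extension of \<open>x \<otimes> e\<^sub>I \<mapsto> \<Sum>i. T\<^sub>i x \<otimes> (e\<^sub>i \<and> e\<^sub>I)\<close>, in all degrees at once. For linear
  \<open>T\<^sub>i\<close> it maps \<open>koszul_space k\<close> into \<open>koszul_space (Suc k)\<close>.
\<close>

definition koszul_map ::
    "('d::{finite,linorder} \<Rightarrow> 'a::chilbert_space \<Rightarrow> 'a) \<Rightarrow> ('d set \<Rightarrow> 'a) \<Rightarrow> 'd set \<Rightarrow> 'a" where
  "koszul_map T x J = (\<Sum>I\<in>UNIV. \<Sum>i\<in>UNIV. wedge_coeff i I J *\<^sub>R T i (x I))"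

text \<open>
  Exactness at \<open>H \<otimes> \<Lambda>\<^sup>0\<close> and at \<open>H \<otimes> \<Lambda>\<^sup>k\<close> for \<open>1 \<le> k \<le> d\<close>. For \<open>k = d\<close> the kernel is all of
  \<open>H \<otimes> \<Lambda>\<^sup>d\<close>.
\<close>

definition koszul_exact :: "('d::{finite,linorder} \<Rightarrow> 'a::chilbert_space \<Rightarrow> 'a) \<Rightarrow> bool" where
  "koszul_exact T \<longleftrightarrow>
     {x \<in> koszul_space 0. koszul_map T x = (\<lambda>_. 0)} = {\<lambda>_. 0} \<and>
     (\<forall>k<CARD('d).
        {x \<in> koszul_space (Suc k). koszul_map T x = (\<lambda>_. 0)} = koszul_map T ` koszul_space k)"

definition taylor_spectrum ::
    "('d::{finite,linorder} \<Rightarrow> 'a::chilbert_space \<Rightarrow> 'a) \<Rightarrow> (complex ^ 'd::{finite,linorder}) set" where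
  "taylor_spectrum T = {l. \<not> koszul_exact (\<lambda>i x. T i x - (l $ i) *\<^sub>C x)}"

definition joint_spectral_radius ::
    "('d::{finite,linorder} \<Rightarrow> 'a::chilbert_space \<Rightarrow> 'a) \<Rightarrow> real" where
  "joint_spectral_radius T =
     (SUP l \<in> taylor_spectrum T. sqrt (\<Sum>i\<in>UNIV. (cmod (l $ i))\<^sup>2))"

end

theory Submission
  imports Defs "HOL-Computational_Algebra.Fundamental_Theorem_Algebra"
begin

text \<open>
  Write \<open>P\<close> for the modulus and put \<open>S = P\<^sup>t\<close>, \<open>A\<^sub>i = V\<^sub>i P\<^bsup>1-t\<^esup>\<close>. Then \<open>T\<^sub>i = A\<^sub>i S\<close> and
  \<open>\<Delta>\<^sub>t(T)\<^sub>i = S A\<^sub>i\<close>, and commutativity of \<open>T\<close> gives \<open>V\<^sub>i P V\<^sub>j = V\<^sub>j P V\<^sub>i\<close> on the range and on the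
  kernel of \<open>P\<close>, hence \<open>A\<^sub>i S A\<^sub>j = A\<^sub>j S A\<^sub>i\<close>. So \<open>S\<close> and each \<open>A\<^sub>j\<close> are chain maps between the two
  Koszul complexes. On the cohomology of \<open>T - \<lambda>\<close> the composite \<open>A\<^sub>j S = T\<^sub>j\<close> acts as \<open>\<lambda>\<^sub>j\<close>, and
  similarly for \<open>S A\<^sub>j\<close>; this settles every \<open>\<lambda> \<noteq> 0\<close>. For \<open>\<lambda> = 0\<close>, exactness of either complex makes
  \<open>S\<close> bijective, so that the tuples are similar: if the complex of \<open>\<Delta>\<^sub>t(T)\<close> is exact, its top degree
  shows that the selfadjoint operator \<open>S\<close> is onto; if the complex of \<open>T\<close> is exact, then \<open>P\<close> is
  injective, and for every \<open>y\<close> the \<open>1\<close>-cocycle \<open>(V\<^sub>i y)\<^sub>i\<close> is a coboundary \<open>(T\<^sub>i z)\<^sub>i = (V\<^sub>i P z)\<^sub>i\<close>, so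
  \<open>y = P z\<close>.
\<close>

section \<open>Complex Hilbert spaces: Riesz representation and adjoints\<close>

lemma cinner_add_right: "cinner x (y + z) = cinner x y + cinner x z" for x :: "'a::chilbert_space"
  by (metis cinner_commute cinner_add_left complex_cnj_add)

lemma cinner_scaleC_right: "cinner x (c *\<^sub>C y) = cnj c * cinner x y" for x :: "'a::chilbert_space"
  by (metis cinner_commute cinner_scaleC_left complex_cnj_mult)

lemma cinner_scaleR_left: "cinner (r *\<^sub>R x) y = r *\<^sub>R cinner x y" for x :: "'a::chilbert_space"
  by (simp add: scaleR_scaleC cinner_scaleC_left scaleR_conv_of_real)

lemma cinner_scaleR_right: "cinner x (r *\<^sub>R y) = r *\<^sub>R cinner x y" for x :: "'a::chilbert_space"
  by (simp add: scaleR_scaleC cinner_scaleC_right scaleR_conv_of_real)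

lemma Re_cinner_commute: "Re (cinner x y) = Re (cinner y x)" for x :: "'a::chilbert_space"
  by (subst cinner_commute) simp

lemma power2_norm_eq_cinner: "(norm x)\<^sup>2 = Re (cinner x x)" for x :: "'a::chilbert_space"
  by (simp add: cinner_self)

lemma power2_norm_add:
  "(norm (x + y))\<^sup>2 = (norm x)\<^sup>2 + 2 * Re (cinner x y) + (norm y)\<^sup>2" for x :: "'a::chilbert_space"
  by (simp add: power2_norm_eq_cinner cinner_add_left cinner_add_right Re_cinner_commute[of y x])

lemma norm_scaleC: "norm (c *\<^sub>C x) = cmod c * norm x" for x :: "'a::chilbert_space"
proof -
  have "complex_of_real ((norm (c *\<^sub>C x))\<^sup>2) = complex_of_real ((cmod c * norm x)\<^sup>2)"
    unfolding cinner_self[symmetric] cinner_scaleC_left cinner_scaleC_right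
    by (simp only: cinner_self of_real_mult power_mult_distrib complex_norm_square)
      (simp only: mult_ac)
  then have "(norm (c *\<^sub>C x))\<^sup>2 = (cmod c * norm x)\<^sup>2"
    using of_real_eq_iff by blast
  then show ?thesis
    by (simp add: power2_eq_iff_nonneg)
qed

text \<open>Expanding the squared norm of \<open>?b x - ?a y\<close> gives
  \<open>2 * (?a * ?b) * (?a * ?b - Re (cinner x y))\<close>. The positive factor can be cancelled
  unless one of the vectors is zero.\<close>

lemma Re_cinner_le: "Re (cinner x y) \<le> norm x * norm y" for x :: "'a::chilbert_space"
proof -
  let ?a = "norm x" and ?b = "norm y"
  have "0 \<le> (norm (?b *\<^sub>R x + - (?a *\<^sub>R y)))\<^sup>2"
    by simp
  also have "\<dots> = 2 * (?a * ?b) * (?a * ?b - Re (cinner x y))"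
    unfolding power2_norm_add
    by (simp add: cinner_scaleR_left cinner_scaleR_right power2_eq_square algebra_simps
        flip: scaleR_minus_left)
  finally have "0 \<le> (?a * ?b) * (?a * ?b - Re (cinner x y))"
    by simp
  moreover have "cinner x y = 0" if "?a * ?b = 0"
  proof -
    have "x = 0 \<or> y = 0" using that by simp
    then show ?thesis
      using cinner_scaleR_left[of 0 x y] cinner_scaleR_right[of x 0 y] by auto
  qed
  ultimately show ?thesis
    by (cases "?a * ?b = 0") (auto simp: zero_le_mult_iff mult_le_0_iff)
qed

text \<open>The unimodular scalar \<open>c\<close> rotates \<open>x\<close> until the inner product
  with \<open>y\<close> is real and nonnegative, so the bound on real parts applies.\<close>

lemma norm_cinner_le: "cmod (cinner x y) \<le> norm x * norm y" for x :: "'a::chilbert_space"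
proof (cases "cinner x y = 0")
  case False
  define c where "c = cnj (cinner x y) / cmod (cinner x y)"
  have "cmod c = 1" using False by (simp add: c_def norm_divide)
  have "cmod (cinner x y) = Re (cinner (c *\<^sub>C x) y)"
    using False by (simp add: c_def cinner_scaleC_left mult.commute
        flip: complex_norm_square) (simp add: power2_eq_square)
  also have "\<dots> \<le> norm x * norm y"
    using Re_cinner_le[of "c *\<^sub>C x" y] \<open>cmod c = 1\<close> by (simp add: norm_scaleC)
  finally show ?thesis .
qed simp

lemma bounded_bilinear_cinner:
  "bounded_bilinear (cinner :: 'a::chilbert_space \<Rightarrow> 'a \<Rightarrow> complex)"
  by (unfold_locales)
    (auto simp: cinner_add_left cinner_add_right cinner_scaleR_left cinner_scaleR_right
      intro!: exI[of _ 1] norm_cinner_le)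

interpretation cinner: bounded_bilinear "cinner :: 'a::chilbert_space \<Rightarrow> 'a \<Rightarrow> complex"
  by (rule bounded_bilinear_cinner)

lemma bounded_linear_scaleC: "bounded_linear (\<lambda>x. c *\<^sub>C x :: 'a::chilbert_space)"
  by (rule bounded_linear_intro[where K = "cmod c"])
    (auto simp: scaleC_add_right norm_scaleC scaleR_scaleC scaleC_scaleC mult.commute)

lemma cinner_left_ext: "(\<And>y. cinner x y = cinner x' y) \<Longrightarrow> x = x'" for x :: "'a::chilbert_space"
  by (metis cinner.diff_left cinner_self eq_iff_diff_eq_0 norm_eq_zero of_real_eq_0_iff
      zero_eq_power2)

lemma cinner_right_ext: "(\<And>y. cinner y x = cinner y x') \<Longrightarrow> x = x'" for x :: "'a::chilbert_space"
  by (metis cinner_commute cinner_left_ext)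

section \<open>Bounded complex-linear maps, Riesz representation and adjoints\<close>

lemma bounded_clinear_imp_bounded_linear: "bounded_clinear A \<Longrightarrow> bounded_linear A"
  by (simp add: bounded_clinear_def)

lemma bounded_clinear_scaleC: "bounded_clinear A \<Longrightarrow> A (c *\<^sub>C x) = c *\<^sub>C A x"
  by (simp add: bounded_clinear_def)

lemma bounded_clinear_id: "bounded_clinear id"
  by (simp add: bounded_clinear_def id_def bounded_linear_ident)

lemma bounded_clinear_compose: "bounded_clinear A \<Longrightarrow> bounded_clinear B \<Longrightarrow> bounded_clinear (A \<circ> B)"
  unfolding bounded_clinear_def o_def by (auto intro: bounded_linear_compose)

lemma bounded_clinearI:
  assumes "\<And>x y. A (x + y) = A x + A y" "\<And>c x. A (c *\<^sub>C x) = c *\<^sub>C A x"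
    and "\<And>x. norm (A x) \<le> norm x * K"
  shows "bounded_clinear A"
  unfolding bounded_clinear_def
  using assms by (auto intro!: bounded_linear_intro[where K = K] simp: scaleR_scaleC)

text \<open>The representing vector is the minimizer of the convex functional \<open>F\<close>. A
  minimizing sequence is Cauchy by the parallelogram law, and the first-order condition at the
  minimum is the claimed identity.\<close>

lemma Riesz_representation_real:
  fixes \<phi> :: "'a::chilbert_space \<Rightarrow> real"
  assumes "bounded_linear \<phi>"
  shows "\<exists>y. \<forall>x. \<phi> x = Re (cinner x y)"
proof -
  interpret \<phi>: bounded_linear \<phi> by fact
  define F where "F = (\<lambda>x. (norm x)\<^sup>2 - 2 * \<phi> x)"
  have F_x: "F x = (norm x)\<^sup>2 - 2 * \<phi> x" for x by (simp add: F_def)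
  obtain K where K: "\<And>x. norm (\<phi> x) \<le> norm x * K"
    using \<phi>.bounded by blast
  \<comment> \<open>Completing the square: \<open>F x\<close> is at least
    \<open>(norm x)\<^sup>2 - 2 * K * norm x\<close>.\<close>
  have lower: "- K\<^sup>2 \<le> F x" for x
  proof -
    have "0 \<le> (norm x - K)\<^sup>2" by simp
    then show ?thesis
      using K[of x] by (simp add: F_def power2_diff)
  qed
  then have bdd: "bdd_below (range F)" by (intro bdd_belowI) auto
  define m where "m = Inf (range F)"
  have m_le: "m \<le> F x" for x
    unfolding m_def using bdd by (intro cInf_lower) auto
  have "\<exists>x. F x < m + inverse (real (Suc n))" for n
    using cInf_lessD[of "range F" "m + inverse (real (Suc n))"] unfolding m_def by auto
  then obtain X where X: "\<And>n. F (X n) < m + inverse (real (Suc n))" by metis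
  \<comment> \<open>The linear parts of \<open>F\<close> cancel here. As the midpoint has value at
    least \<open>m\<close>, two almost minimal points must be close to each other.\<close>
  have parallelogram: "(norm (x - y))\<^sup>2 = 2 * F x + 2 * F y - 4 * F ((1/2) *\<^sub>R (x + y))" for x y
  proof -
    have "(norm ((1/2) *\<^sub>R (x + y)))\<^sup>2 = (norm (x + y))\<^sup>2 / 4"
      by (simp only: norm_scaleR power_mult_distrib) (simp add: power_divide)
    moreover have "\<phi> ((1/2) *\<^sub>R (x + y)) = (\<phi> x + \<phi> y) / 2"
      by (simp only: \<phi>.scaleR \<phi>.add) simp
    ultimately have "F ((1/2) *\<^sub>R (x + y)) = (norm (x + y))\<^sup>2 / 4 - (\<phi> x + \<phi> y)"
      by (simp only: F_def) argo
    then show ?thesis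
      using power2_norm_add[of x y] power2_norm_add[of x "-y"] F_x[of x] F_x[of y]
      by (simp only: cinner.minus_right uminus_complex.sel
          norm_minus_cancel add_uminus_conv_diff) argo
  qed
  have dist_X: "(norm (X i - X j))\<^sup>2 \<le> 4 * inverse (real (Suc n))" if "n \<le> i" "n \<le> j" for i j n
  proof -
    have "inverse (real (Suc i)) \<le> inverse (real (Suc n))" "inverse (real (Suc j)) \<le> inverse (real (Suc n))"
      using that by auto
    then show ?thesis
      using X[of i] X[of j] m_le[of "(1/2) *\<^sub>R (X i + X j)"] unfolding parallelogram by linarith
  qed
  have "Cauchy X"
  proof (rule CauchyI)
    fix e :: real assume "0 < e"
    then obtain n where n: "inverse (real (Suc n)) < e\<^sup>2 / 4"
      using reals_Archimedean[of "e\<^sup>2 / 4"] by auto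
    have "norm (X i - X j) < e" if "n \<le> i" "n \<le> j" for i j
    proof (rule power2_less_imp_less)
      show "(norm (X i - X j))\<^sup>2 < e\<^sup>2" using dist_X[OF that] n by linarith
      show "0 \<le> e" using \<open>0 < e\<close> by simp
    qed
    then show "\<exists>n. \<forall>i\<ge>n. \<forall>j\<ge>n. norm (X i - X j) < e" by blast
  qed
  then obtain y where y: "X \<longlonglongrightarrow> y" using Cauchy_convergent convergent_def by blast
  have "(\<lambda>n. F (X n)) \<longlonglongrightarrow> F y"
    unfolding F_def by (intro tendsto_intros y \<phi>.tendsto)
  moreover have "(\<lambda>n. m + inverse (real (Suc n))) \<longlonglongrightarrow> m"
    using LIMSEQ_inverse_real_of_nat_add by blast
  ultimately have "F y \<le> m"
    using X by (intro LIMSEQ_le) (auto intro: less_imp_le)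
  then have min: "F y \<le> F x" for x using m_le[of x] by linarith
  have "\<phi> x = Re (cinner x y)" for x
  proof -
    define b where "b = Re (cinner x y) - \<phi> x"
    have quad: "0 \<le> s\<^sup>2 * (norm x)\<^sup>2 + 2 * s * b" for s
      using min[of "y + s *\<^sub>R x"] unfolding F_def power2_norm_add \<phi>.add \<phi>.scaleR b_def
      by (simp add: cinner_scaleR_right power_mult_distrib Re_cinner_commute[of x y] algebra_simps)
    \<comment> \<open>The summand 1 keeps \<open>q\<close> positive even for \<open>x = 0\<close>;
      the choice \<open>s = - (b / q)\<close> then turns \<open>quad\<close> into
      \<open>0 \<le> - (b\<^sup>2 / q)\<close>, which forces \<open>b = 0\<close>.\<close>
    define q where "q = (norm x)\<^sup>2 + 1"
    have "0 < q" unfolding q_def by (rule add_nonneg_pos) auto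
    have "0 \<le> (b / q)\<^sup>2 * (norm x)\<^sup>2 + 2 * (- (b / q)) * b"
      using quad[of "- (b / q)"] by simp
    also have "\<dots> \<le> (b / q)\<^sup>2 * q + 2 * (- (b / q)) * b"
      by (intro add_right_mono mult_left_mono) (auto simp: q_def)
    also have "\<dots> = - (b\<^sup>2 / q)"
      using \<open>0 < q\<close> by (simp add: field_simps power2_eq_square)
    finally have "b\<^sup>2 \<le> 0"
      using \<open>0 < q\<close> by (simp add: divide_le_0_iff)
    then show ?thesis by (simp add: b_def)
  qed
  then show ?thesis by blast
qed

text \<open>For each \<open>y\<close>, Riesz representation of the real part of
  \<open>cinner (A x) y\<close> yields the value \<open>B y\<close>. Linearity of \<open>B\<close>
  follows from uniqueness of representing vectors, and its bound from the squared norm of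
  \<open>B y\<close> being \<open>cinner (A (B y)) y\<close>.\<close>

lemma cadjoint_exists:
  assumes A: "bounded_clinear A"
  shows "\<exists>B. bounded_clinear B \<and> (\<forall>x y. cinner (A x) y = cinner x (B y))"
proof -
  interpret A: bounded_linear A using A by (rule bounded_clinear_imp_bounded_linear)
  have "\<exists>z. \<forall>x. cinner (A x) y = cinner x z" for y
  proof -
    have "bounded_linear (\<lambda>x. Re (cinner (A x) y))"
      by (intro bounded_linear_compose[OF bounded_linear_Re]
          bounded_linear_compose[OF cinner.bounded_linear_left A.bounded_linear_axioms])
    then obtain z where z: "\<And>x. Re (cinner (A x) y) = Re (cinner x z)"
      using Riesz_representation_real by blast
    \<comment> \<open>Multiplying \<open>x\<close> by the imaginary unit turns imaginary parts into
      real parts, up to sign.\<close>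
    have "Im (cinner (A x) y) = Im (cinner x z)" for x
      using z[of "\<i> *\<^sub>C x"] by (simp add: bounded_clinear_scaleC[OF A] cinner_scaleC_left)
    with z show ?thesis by (metis complex_eqI)
  qed
  then obtain B where B: "\<And>x y. cinner (A x) y = cinner x (B y)" by metis
  obtain K where K: "K > 0" "\<And>x. norm (A x) \<le> norm x * K" using A.pos_bounded by blast
  have "norm (B y) \<le> norm y * K" for y
  proof -
    have "norm (B y) * norm (B y) = Re (cinner (A (B y)) y)"
      by (simp add: B cinner_self power2_eq_square)
    also have "\<dots> \<le> norm (A (B y)) * norm y"
      by (rule Re_cinner_le)
    also have "\<dots> \<le> norm (B y) * K * norm y"
      by (intro mult_right_mono K) auto
    finally have "norm (B y) * norm (B y) \<le> norm (B y) * (norm y * K)"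
      by (simp add: mult_ac)
    then show ?thesis
      by (cases "norm (B y) = 0") (use K in \<open>auto simp: mult_le_cancel_left\<close>)
  qed
  moreover have "B (x + y) = B x + B y" for x y
    by (rule cinner_right_ext) (simp add: B[symmetric] cinner_add_right)
  moreover have "B (c *\<^sub>C x) = c *\<^sub>C B x" for c x
    by (rule cinner_right_ext) (simp add: B[symmetric] cinner_scaleC_right)
  ultimately show ?thesis using B bounded_clinearI by blast
qed

lemma
  assumes "bounded_clinear A"
  shows bounded_clinear_cadjoint: "bounded_clinear (cadjoint A)"
    and cinner_cadjoint: "cinner (A x) y = cinner x (cadjoint A y)"
proof -
  have "\<exists>!B. bounded_clinear B \<and> (\<forall>x y. cinner (A x) y = cinner x (B y))"
  proof (rule ex_ex1I[OF cadjoint_exists[OF assms]])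
    fix B C
    assume "bounded_clinear B \<and> (\<forall>x y. cinner (A x) y = cinner x (B y))"
      and "bounded_clinear C \<and> (\<forall>x y. cinner (A x) y = cinner x (C y))"
    then have "cinner x (B y) = cinner x (C y)" for x y by metis
    then show "B = C" by (intro ext cinner_right_ext)
  qed
  from theI'[OF this] show "bounded_clinear (cadjoint A)" "cinner (A x) y = cinner x (cadjoint A y)"
    unfolding cadjoint_def by blast+
qed

section \<open>Positive operators\<close>

lemma positive_op_imp_bounded_clinear: "positive_op A \<Longrightarrow> bounded_clinear A"
  by (simp add: positive_op_def)

lemma positive_op_imp_bounded_linear: "positive_op A \<Longrightarrow> bounded_linear A"
  by (simp add: positive_op_def bounded_clinear_def)

lemma positive_op_Re_cinner: "positive_op A \<Longrightarrow> 0 \<le> Re (cinner (A x) x)"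
  by (auto simp: positive_op_def complex_nonneg_Reals_iff)

text \<open>Polarization: reality of the quadratic form at \<open>x + y\<close> settles the
  imaginary parts, and at \<open>x + \<i> *\<^sub>C y\<close> the real parts.\<close>

lemma positive_op_selfadjoint:
  assumes A: "positive_op A"
  shows "cinner (A x) y = cinner x (A y)"
proof -
  interpret A: bounded_linear A using A by (rule positive_op_imp_bounded_linear)
  have real: "Im (cinner (A z) z) = 0" for z
    using A by (auto simp: positive_op_def complex_nonneg_Reals_iff)
  have "Im (cinner (A x) y) + Im (cinner (A y) x) = 0"
    using real[of "x + y"] real[of x] real[of y]
    by (simp add: A.add cinner_add_left cinner_add_right)
  moreover have "Re (cinner (A y) x) - Re (cinner (A x) y) = 0"
    using real[of "x + \<i> *\<^sub>C y"] real[of x] real[of y]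
    by (simp add: A.add bounded_clinear_scaleC[OF positive_op_imp_bounded_clinear[OF A]]
        cinner_add_left cinner_add_right cinner_scaleC_left cinner_scaleC_right)
  ultimately have "cinner (A x) y = cnj (cinner (A y) x)"
    by (intro complex_eqI) auto
  then show ?thesis using cinner_commute[of x "A y"] by simp
qed

lemma positive_opI:
  assumes "bounded_clinear A" "\<And>x y. cinner (A x) y = cinner x (A y)" "\<And>x. 0 \<le> Re (cinner (A x) x)"
  shows "positive_op A"
proof -
  have "Im (cinner (A x) x) = 0" for x
    using arg_cong[OF cinner_commute[of "A x" x], of Im] assms(2)[of x x] by simp
  then show ?thesis using assms by (auto simp: positive_op_def complex_nonneg_Reals_iff)
qed

section \<open>Polynomials of a positive operator\<close>

text \<open>A free upper limit of summation allows polynomials of different degrees, and sums with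
  cancelling leading terms, to be compared termwise.\<close>

lemma op_poly_degree_le:
  assumes "degree p \<le> n"
  shows "op_poly p A x = (\<Sum>k\<le>n. coeff p k *\<^sub>R (A ^^ k) x)"
  unfolding op_poly_def
  by (rule sum.mono_neutral_left) (use assms in \<open>auto simp: coeff_eq_0\<close>)

lemma op_poly_0 [simp]: "op_poly 0 A x = 0"
  by (simp add: op_poly_def)

lemma op_poly_const [simp]: "op_poly [:c:] A x = c *\<^sub>R x"
  by (simp add: op_poly_def)

lemma op_poly_add: "op_poly (p + q) A x = op_poly p A x + op_poly q A x"
proof -
  let ?n = "max (degree p) (degree q)"
  show ?thesis
    using op_poly_degree_le[of "p + q" ?n A x] op_poly_degree_le[of p ?n A x]
      op_poly_degree_le[of q ?n A x] degree_add_le_max[of p q]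
    by (simp add: scaleR_add_left sum.distrib)
qed

lemma op_poly_smult: "op_poly (smult c p) A x = c *\<^sub>R op_poly p A x"
  using op_poly_degree_le[of "smult c p" "degree p" A x]
  by (simp add: op_poly_def scaleR_sum_right degree_smult_le)

lemma op_poly_minus: "op_poly (- p) A x = - op_poly p A x"
  using op_poly_smult[of "-1" p A x] by simp

lemma op_poly_diff: "op_poly (p - q) A x = op_poly p A x - op_poly q A x"
  using op_poly_add[of p "- q" A x] by (simp add: op_poly_minus)

text \<open>The Horner step; it drives the inductions over polynomials below.\<close>

lemma op_poly_pCons:
  assumes "bounded_linear A"
  shows "op_poly (pCons c p) A x = c *\<^sub>R x + A (op_poly p A x)"
proof -
  interpret bounded_linear A by fact
  have "op_poly (pCons c p) A x = (\<Sum>k\<le>Suc (degree p). coeff (pCons c p) k *\<^sub>R (A ^^ k) x)"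
    by (rule op_poly_degree_le) (rule degree_pCons_le)
  also have "\<dots> = c *\<^sub>R x + A (op_poly p A x)"
    by (subst sum.atMost_Suc_shift) (simp add: op_poly_def sum scaleR)
  finally show ?thesis .
qed

lemma bounded_clinear_op_poly:
  assumes "bounded_clinear A"
  shows "bounded_clinear (op_poly p A)"
proof (induction p)
  case 0
  show ?case by (rule bounded_clinearI[where K = 0]) auto
next
  case (pCons c p)
  have A: "bounded_linear A" using assms by (rule bounded_clinear_imp_bounded_linear)
  have "bounded_linear (\<lambda>x. c *\<^sub>R x + A (op_poly p A x))"
    by (intro bounded_linear_add bounded_linear_scaleR_right
        bounded_linear_compose[OF A bounded_clinear_imp_bounded_linear[OF pCons.IH]])
  then have "bounded_linear (op_poly (pCons c p) A)"
    by (simp add: op_poly_pCons[OF A, abs_def])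
  then show ?case
    unfolding bounded_clinear_def
    by (auto simp: op_poly_pCons[OF A] scaleC_add_right scaleR_scaleC scaleC_scaleC mult.commute
        bounded_clinear_scaleC[OF assms] bounded_clinear_scaleC[OF pCons.IH])
qed

lemma bounded_linear_op_poly: "bounded_clinear A \<Longrightarrow> bounded_linear (op_poly p A)"
  by (intro bounded_clinear_imp_bounded_linear bounded_clinear_op_poly)

lemma op_poly_commute:
  assumes "bounded_clinear A" "bounded_linear B" "\<And>x. A (B x) = B (A x)"
  shows "op_poly p A (B x) = B (op_poly p A x)"
proof (induction p)
  interpret B: bounded_linear B by fact
  case 0
  show ?case by (simp add: B.zero)
next
  interpret B: bounded_linear B by fact
  case (pCons c p)
  then show ?case
    using assms(3)
    by (simp add: op_poly_pCons bounded_clinear_imp_bounded_linear[OF assms(1)] B.add B.scaleR)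
qed

lemma op_poly_mult:
  assumes "bounded_clinear A"
  shows "op_poly (p * q) A x = op_poly p A (op_poly q A x)"
proof (induction p)
  case (pCons c p)
  have "op_poly (pCons c p * q) A x = op_poly (smult c q + pCons 0 (p * q)) A x"
    by (simp add: mult_pCons_left)
  then show ?case
    using pCons.IH
    by (simp add: op_poly_add op_poly_smult
        op_poly_pCons[OF bounded_clinear_imp_bounded_linear[OF assms]])
qed simp

lemma op_poly_selfadjoint:
  assumes A: "positive_op A"
  shows "cinner (op_poly p A x) y = cinner x (op_poly p A y)"
proof (induction p arbitrary: x y)
  case (pCons c p)
  have cl: "bounded_clinear A" and bl: "bounded_linear A"
    using A positive_op_imp_bounded_clinear positive_op_imp_bounded_linear by blast+
  have "op_poly p A (A y) = A (op_poly p A y)"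
    by (rule op_poly_commute[OF cl bl]) simp
  then show ?case
    using pCons.IH
    by (simp add: op_poly_pCons[OF bl] cinner_add_left cinner_add_right cinner_scaleR_left
        cinner_scaleR_right positive_op_selfadjoint[OF A])
qed (simp add: cinner.zero_left cinner.zero_right)

text \<open>One of the two factors \<open>op_poly q A\<close> moves across the inner product.
  Consequently a square factor preserves positivity of the quadratic form.\<close>

lemma Re_cinner_op_poly_square_mult:
  assumes A: "positive_op A"
  shows "Re (cinner (op_poly (q\<^sup>2 * p) A x) x) = Re (cinner (op_poly p A (op_poly q A x)) (op_poly q A x))"
proof -
  have cl: "bounded_clinear A"
    using A by (rule positive_op_imp_bounded_clinear)
  have "op_poly (q\<^sup>2 * p) A x = op_poly q A (op_poly p A (op_poly q A x))"
    by (simp add: op_poly_mult[OF cl, symmetric] power2_eq_square mult_ac)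
  then show ?thesis by (simp add: op_poly_selfadjoint[OF A])
qed

text \<open>The real part carries all the information when \<open>A\<close> is positive, since
  \<open>op_poly p A\<close> is then selfadjoint.\<close>

definition positive_at :: "real poly \<Rightarrow> ('a::chilbert_space \<Rightarrow> 'a) \<Rightarrow> bool" where
  "positive_at p A \<longleftrightarrow> (\<forall>x. 0 \<le> Re (cinner (op_poly p A x) x))"

lemma positive_at_add: "positive_at p A \<Longrightarrow> positive_at q A \<Longrightarrow> positive_at (p + q) A"
  by (simp add: positive_at_def op_poly_add cinner_add_left)

lemma positive_at_smult: "0 \<le> c \<Longrightarrow> positive_at p A \<Longrightarrow> positive_at (smult c p) A"
  by (simp add: positive_at_def op_poly_smult cinner_scaleR_left)

lemma positive_at_square_mult: "positive_op A \<Longrightarrow> positive_at p A \<Longrightarrow> positive_at (q\<^sup>2 * p) A"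
  by (simp add: positive_at_def Re_cinner_op_poly_square_mult)

section \<open>Factors of real polynomials\<close>

lemma poly_map_of_real:
  "poly (map_poly complex_of_real (p + q)) z
     = poly (map_poly complex_of_real p) z + poly (map_poly complex_of_real q) z"
  "poly (map_poly complex_of_real (p * q)) z
     = poly (map_poly complex_of_real p) z * poly (map_poly complex_of_real q) z"
  "poly (map_poly complex_of_real p) (complex_of_real x) = complex_of_real (poly p x)"
proof -
  have add: "map_poly complex_of_real (p + q) = map_poly complex_of_real p + map_poly complex_of_real q"
    for p q by (rule poly_eqI) (simp add: coeff_map_poly)
  show "poly (map_poly complex_of_real (p + q)) z
     = poly (map_poly complex_of_real p) z + poly (map_poly complex_of_real q) z"
    by (simp add: add)
  show "poly (map_poly complex_of_real (p * q)) z
     = poly (map_poly complex_of_real p) z * poly (map_poly complex_of_real q) z"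
    by (induction p) (simp_all add: add map_poly_pCons map_poly_smult algebra_simps)
  show "poly (map_poly complex_of_real p) (complex_of_real x) = complex_of_real (poly p x)"
    by (induction p) (simp_all add: map_poly_pCons)
qed

text \<open>The complexified polynomial has a root \<open>z\<close>. A real root splits off a linear
  factor; a non-real one splits off the quadratic with roots \<open>z\<close> and
  \<open>cnj z\<close>.\<close>

lemma poly_root_cases:
  fixes p :: "real poly"
  assumes "0 < degree p"
  obtains (real) z q where "p = [:-z, 1:] * q"
    | (complex) a b q where "b \<noteq> 0" "p = ([:-a, 1:]\<^sup>2 + [:b\<^sup>2:]) * q"
proof -
  have "degree (map_poly complex_of_real p) = degree p"
    by (rule degree_map_poly) simp
  then have "\<not> constant (poly (map_poly complex_of_real p))"
    using assms by (simp add: constant_degree)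
  then obtain z where z: "poly (map_poly complex_of_real p) z = 0"
    using fundamental_theorem_of_algebra by blast
  show ?thesis
  proof (cases "Im z = 0")
    case True
    then have "z = complex_of_real (Re z)" by (simp add: complex_eq_iff)
    with z have "poly p (Re z) = 0"
      by (metis poly_map_of_real(3) of_real_eq_0_iff)
    then show ?thesis using real by (auto simp: poly_eq_0_iff_dvd dvd_def)
  next
    case False
    define m where "m = [:- Re z, 1:]\<^sup>2 + [:(Im z)\<^sup>2:]"
    have m: "m = [:(Re z)\<^sup>2 + (Im z)\<^sup>2, - 2 * Re z, 1:]"
      by (simp add: m_def power2_eq_square)
    have "degree m = 2" by (simp add: m)
    define r where "r = p mod m"
    have "degree r < 2"
      using degree_mod_less[of m p] \<open>degree m = 2\<close> unfolding r_def by fastforce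
    then have r: "r = [:coeff r 0, coeff r 1:]"
      by (intro poly_eqI) (auto simp: coeff_pCons coeff_eq_0 split: nat.split)
    define r0 r1 where "r0 = coeff r 0" and "r1 = coeff r 1"
    with r have r: "r = [:r0, r1:]" by simp
    have p: "m * (p div m) + r = p" by (simp add: r_def)
    have mz: "poly (map_poly complex_of_real m) z = 0"
      by (simp add: m map_poly_pCons complex_eq_iff power2_eq_square algebra_simps)
    then have "poly (map_poly complex_of_real r) z = 0"
      using z mz poly_map_of_real(1)[of "m * (p div m)" r z, unfolded p] poly_map_of_real(2)[of m "p div m" z]
      by (simp only:) simp
    \<comment> \<open>The imaginary part of \<open>r0 + r1 * z = 0\<close> kills \<open>r1\<close>
      because \<open>Im z\<close> is nonzero, and then the real part kills
      \<open>r0\<close>.\<close>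
    then have "r0 = 0 \<and> r1 = 0"
      using False by (auto simp: r map_poly_pCons complex_eq_iff)
    then have "p = m * (p div m)"
      using p r by simp
    then show ?thesis using complex[OF False] unfolding m_def by blast
  qed
qed

text \<open>A single point is never isolated in a nondegenerate interval, so continuity carries the
  inequality over to it. This recovers the sign of a cofactor at a root, where the sign of the
  product says nothing.\<close>

lemma nonneg_Icc_except_point:
  fixes f :: "real \<Rightarrow> real"
  assumes "a < b" "x \<in> {a..b}" "isCont f x" "\<And>y. y \<in> {a..b} \<Longrightarrow> y \<noteq> z \<Longrightarrow> 0 \<le> f y"
  shows "0 \<le> f x"
proof (rule tendsto_lowerbound)
  show "(f \<longlongrightarrow> f x) (at x within {a..b})"
    using continuous_at_imp_continuous_at_within[OF assms(3)] by (simp only: continuous_within)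
  show "\<forall>\<^sub>F y in at x within {a..b}. 0 \<le> f y"
    using eventually_neq_at_within[of z x "{a..b}"]
    by (auto simp: eventually_at_filter assms(4) elim: eventually_mono)
  show "at x within {a..b} \<noteq> bot"
    using assms(1,2) islimpt_Icc[of a b x] by (simp add: trivial_limit_within)
qed

text \<open>
  The four conclusions are proved together because each linear factor of \<open>p\<close> is a nonnegative
  combination of \<open>X\<close>, \<open>M - X\<close> and constants, and multiplying by it permutes the four cases up to a
  square. This avoids the fact that products of commuting positive operators are positive.
\<close>

lemma positive_at_weighted:
  assumes A: "positive_op A" and M: "0 < M" "onorm A \<le> M"
    and p: "\<And>x. x \<in> {0..M} \<Longrightarrow> 0 \<le> poly p x"
  defines "X \<equiv> [:0, 1:]" and "Y \<equiv> [:M, -1:]"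
  shows "positive_at p A \<and> positive_at (X * p) A \<and> positive_at (Y * p) A \<and> positive_at (X * (Y * p)) A"
  using p
proof (induction "degree p" arbitrary: p rule: less_induct)
  case less
  let ?P = "\<lambda>p. positive_at p A \<and> positive_at (X * p) A \<and> positive_at (Y * p) A \<and> positive_at (X * (Y * p)) A"
  have A_lin: "bounded_linear A" using A by (rule positive_op_imp_bounded_linear)
  then interpret A: bounded_linear A .
  have add: "?P (p + q)" if "?P p" "?P q" for p q
    using that by (simp add: distrib_left positive_at_add)
  have smult: "?P (smult c p)" if "?P p" "0 \<le> c" for c p
    using that by (simp add: positive_at_smult)
  have square: "?P (q\<^sup>2 * p)" if "?P p" for p q
  proof -
    have "X * (q\<^sup>2 * p) = q\<^sup>2 * (X * p)" "Y * (q\<^sup>2 * p) = q\<^sup>2 * (Y * p)"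
      "X * (q\<^sup>2 * (Y * p)) = q\<^sup>2 * (X * (Y * p))"
      by (rule mult.left_commute)+
    then show ?thesis using that positive_at_square_mult[OF A] by (simp only:)
  qed
  \<comment> \<open>Multiplication by \<open>X\<close> permutes \<open>p\<close>,
    \<open>X * p\<close>, \<open>Y * p\<close> and \<open>X * (Y * p)\<close> up to a factor
    \<open>X\<^sup>2\<close>, which preserves positivity.\<close>
  have X_mult: "?P (X * p)" if "?P p" for p
  proof -
    have "X * (Y * (X * p)) = X\<^sup>2 * (Y * p)" "X * (X * p) = X\<^sup>2 * p" "Y * (X * p) = X * (Y * p)"
      by (simp_all only: power2_eq_square mult.assoc mult.left_commute[of Y X])
    then show ?thesis
      using that positive_at_square_mult[OF A, of p X] positive_at_square_mult[OF A, of "Y * p" X]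
      by (simp only:)
  qed
  have Y_mult: "?P (Y * p)" if "?P p" for p
  proof -
    have "X * (Y * (Y * p)) = Y\<^sup>2 * (X * p)" "Y * (Y * p) = Y\<^sup>2 * p"
      by (simp_all only: power2_eq_square mult.assoc mult.left_commute[of Y X])
    then show ?thesis
      using that positive_at_square_mult[OF A, of p Y] positive_at_square_mult[OF A, of "X * p" Y]
      by (simp only:)
  qed
  \<comment> \<open>Dividing by \<open>x - z\<close> gives information only for
    \<open>x \<noteq> z\<close>, hence the exceptional point in this form of the induction
    hypothesis.\<close>
  have IH: "?P q" if "degree q < degree p" "\<And>x. x \<in> {0..M} \<Longrightarrow> x \<noteq> z \<Longrightarrow> 0 \<le> poly q x" for q z
  proof (rule less.hyps[OF that(1)])
    fix x assume "x \<in> {0..M}"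
    then show "0 \<le> poly q x"
      using M(1) that(2) by (intro nonneg_Icc_except_point[of 0 M x "poly q" z]) auto
  qed
  show ?case
  proof (cases "degree p = 0")
    case True
    then obtain c where c: "p = smult c 1" by (metis degree_eq_zeroE smult_one)
    then have "0 \<le> c" using less.prems[of 0] M by simp
    moreover have "?P 1"
    proof -
      have 1: "positive_at 1 A"
        by (simp add: positive_at_def one_pCons cinner_self)
      have X: "positive_at X A"
        using positive_op_Re_cinner[OF A] by (simp add: positive_at_def X_def op_poly_pCons[OF A_lin] A.zero)
      have Y: "positive_at Y A"
        unfolding positive_at_def
      proof
        fix x
        have "Re (cinner (A x) x) \<le> norm (A x) * norm x" by (rule Re_cinner_le)
        also have "\<dots> \<le> (M * norm x) * norm x"
          using onorm[OF A_lin, of x] mult_right_mono[OF M(2), of "norm x"]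
          by (intro mult_right_mono) auto
        finally show "0 \<le> Re (cinner (op_poly Y A x) x)"
          by (simp add: Y_def op_poly_pCons[OF A_lin] cinner_add_left cinner_scaleR_left cinner_self
              A.zero A.neg cinner.diff_left cinner.minus_left power2_eq_square)
      qed
      have "X + Y = [:M:]" by (simp add: X_def Y_def)
      \<comment> \<open>Since \<open>X + Y\<close> is the constant \<open>M\<close>, the product
        \<open>X * Y\<close> becomes a nonnegative combination of squares times \<open>X\<close> or
        \<open>Y\<close>, whose positivity is known.\<close>
      then have "smult M (X * Y) = (X + Y) * (X * Y)" by simp
      also have "\<dots> = X\<^sup>2 * Y + Y\<^sup>2 * X"
        by (simp only: power2_eq_square distrib_right mult.assoc mult.left_commute[of Y X]
            mult.commute[of Y X])
      finally have E: "smult M (X * Y) = X\<^sup>2 * Y + Y\<^sup>2 * X" .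
      have "X * Y = smult (1/M) (X\<^sup>2 * Y + Y\<^sup>2 * X)"
        unfolding E[symmetric] using M by simp
      moreover have "positive_at (smult (1/M) (X\<^sup>2 * Y + Y\<^sup>2 * X)) A"
        using M X Y A by (intro positive_at_smult positive_at_add positive_at_square_mult) auto
      ultimately show ?thesis using 1 X Y by simp
    qed
    ultimately show ?thesis unfolding c by (intro smult)
  next
    case False
    then have "0 < degree p" by simp
    then show ?thesis
    proof (cases rule: poly_root_cases)
      case (real z q)
      have "q \<noteq> 0" using False real by auto
      then have deg: "degree q < degree p"
        unfolding real by (subst degree_mult_eq) auto
      have eval: "0 \<le> (x - z) * poly q x" if "x \<in> {0..M}" for x
        using less.prems[OF that] by (simp add: real algebra_simps)
      \<comment> \<open>To the left of the interval, \<open>x - z\<close> is \<open>X\<close> plus a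
        nonnegative constant; to the right, \<open>z - x\<close> is \<open>Y\<close> plus a
        nonnegative constant; inside, the root has to be a multiple one.\<close>
      consider "z \<le> 0" | "M \<le> z" | "0 < z" "z < M" by linarith
      then show ?thesis
      proof cases
        case 1
        have "?P q"
        proof (rule IH[OF deg, of z])
          fix x assume "x \<in> {0..M}" "x \<noteq> z"
          with eval[of x] 1 show "0 \<le> poly q x" by (auto simp: zero_le_mult_iff)
        qed
        moreover have "p = X * q + smult (- z) q"
          by (simp add: real X_def)
        ultimately show ?thesis
          using add[OF X_mult[of q] smult[where c = "- z" and p = q]] 1 by (simp only: neg_0_le_iff_le)
      next
        case 2
        have "?P (- q)"
        proof (rule IH[of _ z])
          fix x assume "x \<in> {0..M}" "x \<noteq> z"
          with eval[of x] 2 show "0 \<le> poly (- q) x" by (auto simp: zero_le_mult_iff)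
        qed (simp add: deg)
        moreover have "p = Y * (- q) + smult (z - M) (- q)"
          by (simp add: real Y_def smult_diff_left)
        ultimately show ?thesis
          using add[OF Y_mult[of "- q"] smult[where c = "z - M" and p = "- q"]] 2 by (simp only: diff_ge_0_iff_ge)
      next
        case 3
        \<comment> \<open>The cofactor is nonnegative to the right of \<open>z\<close> and
          nonpositive to the left, so it vanishes at \<open>z\<close> and a full square can be split
          off.\<close>
        have "0 \<le> poly q z"
        proof (rule nonneg_Icc_except_point[of z M z "poly q" z])
          fix y assume "y \<in> {z..M}" "y \<noteq> z"
          with eval[of y] 3 show "0 \<le> poly q y" by (auto simp: zero_le_mult_iff)
        qed (use 3 in simp_all)
        moreover have "0 \<le> poly (- q) z"
        proof (rule nonneg_Icc_except_point[of 0 z z "poly (- q)" z])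
          fix y assume "y \<in> {0..z}" "y \<noteq> z"
          with eval[of y] 3 show "0 \<le> poly (- q) y" by (auto simp: zero_le_mult_iff)
        qed (use 3 in simp_all)
        ultimately have "poly q z = 0" by simp
        then obtain r where r: "q = [:- z, 1:] * r" by (auto simp: poly_eq_0_iff_dvd dvd_def)
        have "r \<noteq> 0" using \<open>q \<noteq> 0\<close> r by auto
        then have "degree r < degree q"
          unfolding r by (subst degree_mult_eq) auto
        have "?P r"
        proof (rule IH[of _ z])
          fix x assume x: "x \<in> {0..M}" "x \<noteq> z"
          then have "0 \<le> (x - z)\<^sup>2 * poly r x"
            using eval[of x] by (simp add: r power2_eq_square algebra_simps)
          then show "0 \<le> poly r x" using x by (simp add: zero_le_mult_iff)
        qed (use \<open>degree r < degree q\<close> deg in simp)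
        moreover have "p = [:- z, 1:]\<^sup>2 * r"
          by (simp only: real r power2_eq_square mult.assoc)
        ultimately show ?thesis using square[where p = r and q = "[:- z, 1:]"] by (simp only:)
      qed
    next
      case (complex a b q)
      let ?m = "[:- a, 1:]\<^sup>2 + [:b\<^sup>2:]"
      have "?m = [:a\<^sup>2 + b\<^sup>2, - 2 * a, 1:]" by (simp add: power2_eq_square)
      then have "degree ?m = 2" by simp
      moreover have "q \<noteq> 0" "?m \<noteq> 0" using False complex by auto
      ultimately have "degree q < degree p"
        unfolding complex(2) by (subst degree_mult_eq) auto
      then have "?P q"
      proof (rule IH)
        fix x assume "x \<in> {0..M}"
        then have "0 \<le> ((x - a)\<^sup>2 + b\<^sup>2) * poly q x"
          using less.prems[of x] unfolding complex(2) by (simp add: power2_eq_square algebra_simps)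
        moreover have "0 < (x - a)\<^sup>2 + b\<^sup>2"
          using complex(1) by (simp add: add_nonneg_pos)
        ultimately show "0 \<le> poly q x" by (simp add: zero_le_mult_iff)
      qed
      moreover have "p = [:- a, 1:]\<^sup>2 * q + smult (b\<^sup>2) q"
        unfolding complex(2) by (simp only: distrib_right) simp
      ultimately show ?thesis
        using add[OF square[where p = q and q = "[:- a, 1:]"] smult[where c = "b\<^sup>2" and p = q]] by (simp only: zero_le_power2)
    qed
  qed
qed

text \<open>The polynomial \<open>[:m\<^sup>2:] - p * p\<close> is nonnegative on the interval,
  hence positive at \<open>A\<close>; its quadratic form is the difference of the squares of the two
  sides. The case \<open>onorm A = 0\<close> is separate because the interval must be nondegenerate
  there.\<close>

lemma op_poly_norm_le:
  assumes A: "positive_op A"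
    and p: "\<And>s. s \<in> {0..onorm A} \<Longrightarrow> \<bar>poly p s\<bar> \<le> m"
  shows "norm (op_poly p A x) \<le> m * norm x"
proof (cases "onorm A = 0")
  case True
  have A_lin: "bounded_linear A" using A by (rule positive_op_imp_bounded_linear)
  then have "A y = 0" for y using True onorm[OF A_lin, of y] by simp
  moreover obtain c q where "p = pCons c q" by (rule pCons_cases)
  ultimately have "op_poly p A x = poly p 0 *\<^sub>R x"
    by (simp add: op_poly_pCons[OF A_lin])
  then show ?thesis
    using p[of 0] True by (simp add: mult_right_mono)
next
  case False
  then have M: "0 < onorm A"
    using onorm_pos_le[OF positive_op_imp_bounded_linear[OF A]] by simp
  then have "0 \<le> m" using p[of 0] by simp
  have "positive_at ([:m\<^sup>2:] - p * p) A"
  proof (rule positive_at_weighted[OF A M order_refl, THEN conjunct1])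
    fix s assume "s \<in> {0..onorm A}"
    from power_mono[OF p[OF this], of 2] show "0 \<le> poly ([:m\<^sup>2:] - p * p) s"
      by (simp add: power2_eq_square)
  qed
  then have "(norm (op_poly p A x))\<^sup>2 \<le> (m * norm x)\<^sup>2"
    unfolding positive_at_def op_poly_diff op_poly_mult[OF positive_op_imp_bounded_clinear[OF A]]
      cinner.diff_left op_poly_selfadjoint[OF A, of p "op_poly p A _"]
    by (simp add: cinner_scaleR_left cinner_self power_mult_distrib)
  then show ?thesis
    by (rule power2_le_imp_le) (simp add: \<open>0 \<le> m\<close>)
qed

section \<open>Continuous functional calculus\<close>

lemma real_polynomial_function_imp_poly:
  fixes g :: "real \<Rightarrow> real"
  assumes "real_polynomial_function g"
  shows "\<exists>p. g = poly p"
  using assms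
proof induction
  case (linear h)
  then have "h x = poly [:0, h 1:] x" for x
    using linear_scale[OF bounded_linear.linear[OF linear], of x 1] by (simp add: mult.commute)
  then show ?case by blast
next
  case (const c)
  have "(\<lambda>x. c) = poly [:c:]" by auto
  then show ?case by blast
next
  case (add f g)
  then obtain p q where "f = poly p" "g = poly q" by blast
  then have "(\<lambda>x. f x + g x) = poly (p + q)" by auto
  then show ?case by blast
next
  case (mult f g)
  then obtain p q where "f = poly p" "g = poly q" by blast
  then have "(\<lambda>x. f x * g x) = poly (p * q)" by auto
  then show ?case by blast
qed

lemma uniform_approx_poly:
  fixes f :: "real \<Rightarrow> real"
  assumes "continuous_on {a..b} f"
  obtains p where "uniform_limit {a..b} (\<lambda>n. poly (p n)) f sequentially"
proof -
  have "\<exists>p. \<forall>x\<in>{a..b}. \<bar>f x - poly p x\<bar> < inverse (real (Suc n))" for n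
  proof -
    obtain g where "real_polynomial_function g" "\<And>x. x \<in> {a..b} \<Longrightarrow> \<bar>f x - g x\<bar> < inverse (real (Suc n))"
      using Stone_Weierstrass_real_polynomial_function[OF compact_Icc assms, of "inverse (real (Suc n))"]
      by auto
    then show ?thesis using real_polynomial_function_imp_poly by metis
  qed
  then obtain p where p: "\<And>n x. x \<in> {a..b} \<Longrightarrow> \<bar>f x - poly (p n) x\<bar> < inverse (real (Suc n))"
    by metis
  have "uniform_limit {a..b} (\<lambda>n. poly (p n)) f sequentially"
  proof (rule uniform_limitI)
    fix e :: real assume "0 < e"
    then obtain N where N: "inverse (real (Suc N)) < e" using reals_Archimedean by blast
    show "\<forall>\<^sub>F n in sequentially. \<forall>x\<in>{a..b}. dist (poly (p n) x) (f x) < e"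
    proof (rule eventually_sequentiallyI[of N], rule ballI)
      fix n x assume "N \<le> n" "x \<in> {a..b}"
      then have "inverse (real (Suc n)) \<le> inverse (real (Suc N))" by simp
      then show "dist (poly (p n) x) (f x) < e"
        using p[OF \<open>x \<in> {a..b}\<close>, of n] N unfolding dist_real_def by linarith
    qed
  qed
  then show ?thesis by (rule that)
qed

lemma onorm_tendsto_0_imp_tendsto:
  fixes F :: "nat \<Rightarrow> 'a::real_normed_vector \<Rightarrow> 'b::real_normed_vector"
  assumes "\<And>n. bounded_linear (F n)" "bounded_linear B"
    and "(\<lambda>n. onorm (\<lambda>x. F n x - B x)) \<longlonglongrightarrow> 0"
  shows "(\<lambda>n. F n x) \<longlonglongrightarrow> B x"
proof -
  have "\<forall>n. norm (F n x - B x) \<le> onorm (\<lambda>x. F n x - B x) * norm x"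
    using onorm[OF bounded_linear_sub[OF assms(1,2)]] by blast
  then have "(\<lambda>n. F n x - B x) \<longlonglongrightarrow> 0"
    by (rule Lim_null_comparison[OF always_eventually tendsto_mult_left_zero[OF assms(3)]])
  then show ?thesis by (rule LIM_zero_cancel)
qed

text \<open>Two polynomials within \<open>e\<close> of \<open>f\<close> on the interval differ by at
  most \<open>2 * e\<close> in operator norm at \<open>A\<close>. This makes the approximants Cauchy
  and also shows that the limit does not depend on the chosen sequence.\<close>

lemma op_fun_exists:
  assumes A: "positive_op A" and f: "continuous_on {0..onorm A} f"
  shows "\<exists>B. bounded_clinear B \<and>
     (\<forall>p :: nat \<Rightarrow> real poly. uniform_limit {0..onorm A} (\<lambda>n. poly (p n)) f sequentially \<longrightarrow>
        (\<lambda>n. onorm (\<lambda>x. op_poly (p n) A x - B x)) \<longlonglongrightarrow> 0)"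
proof -
  have cl: "bounded_clinear A" using A by (rule positive_op_imp_bounded_clinear)
  define close where "close = (\<lambda>e q. \<forall>s\<in>{0..onorm A}. \<bar>poly q s - f s\<bar> \<le> e)"
  have ev_close: "\<forall>\<^sub>F n in sequentially. close e (p n)"
    if "uniform_limit {0..onorm A} (\<lambda>n. poly (p n)) f sequentially" "0 < e" for p :: "nat \<Rightarrow> real poly" and e
    using uniform_limitD[OF that] unfolding close_def
    by (rule eventually_mono) (auto simp: dist_real_def intro: less_imp_le)
  have diff: "norm (op_poly p A x - op_poly q A x) \<le> 2 * e * norm x" if "close e p" "close e q" for p q e x
  proof -
    have "\<bar>poly (p - q) s\<bar> \<le> 2 * e" if "s \<in> {0..onorm A}" for s
      using \<open>close e p\<close> \<open>close e q\<close> that unfolding close_def poly_diff by (smt (verit, best))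
    from op_poly_norm_le[OF A this] show ?thesis by (simp add: op_poly_diff)
  qed
  obtain p where p: "uniform_limit {0..onorm A} (\<lambda>n. poly (p n)) f sequentially"
    using uniform_approx_poly[OF f] .
  have "Cauchy (\<lambda>n. op_poly (p n) A x)" for x
  proof (rule CauchyI)
    fix e :: real assume "0 < e"
    \<comment> \<open>The summand 1 makes the denominator positive also for
      \<open>x = 0\<close>.\<close>
    define d where "d = e / (2 * norm x + 1)"
    have pos: "0 < 2 * norm x + 1" by (rule add_nonneg_pos) auto
    then have "0 < d" using \<open>0 < e\<close> by (simp add: d_def)
    have "2 * d * norm x < d * (2 * norm x + 1)" using \<open>0 < d\<close> by (simp add: algebra_simps)
    also have "\<dots> = e" using pos by (simp add: d_def)
    finally have small: "2 * d * norm x < e" .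
    obtain N where N: "\<And>n. N \<le> n \<Longrightarrow> close d (p n)"
      using ev_close[OF p \<open>0 < d\<close>] unfolding eventually_sequentially by blast
    show "\<exists>N. \<forall>m\<ge>N. \<forall>n\<ge>N. norm (op_poly (p m) A x - op_poly (p n) A x) < e"
      using diff[OF N N] small by (meson le_less_trans)
  qed
  then have "\<exists>y. (\<lambda>n. op_poly (p n) A x) \<longlonglongrightarrow> y" for x
    using Cauchy_convergent convergent_def by blast
  then obtain B where B: "\<And>x. (\<lambda>n. op_poly (p n) A x) \<longlonglongrightarrow> B x" by metis
  have close_B: "norm (op_poly q A x - B x) \<le> 2 * e * norm x" if "close e q" "0 < e" for q e x
  proof (rule tendsto_upperbound)
    show "(\<lambda>n. norm (op_poly q A x - op_poly (p n) A x)) \<longlonglongrightarrow> norm (op_poly q A x - B x)"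
      by (intro tendsto_intros B)
    show "\<forall>\<^sub>F n in sequentially. norm (op_poly q A x - op_poly (p n) A x) \<le> 2 * e * norm x"
      using ev_close[OF p that(2)] by (rule eventually_mono) (rule diff[OF that(1)])
  qed simp
  have B_cl: "bounded_clinear B"
  proof -
    \<comment> \<open>A single approximant within distance 1 of \<open>f\<close> bounds the limit:
      \<open>B\<close> differs from it by at most \<open>2 * norm x\<close>.\<close>
    have "\<exists>q. close 1 q" using eventually_happens[OF ev_close[OF p, of 1]] by auto
    then obtain q where q: "close 1 q" ..
    have q_cl: "bounded_clinear (op_poly r A)" for r using cl by (rule bounded_clinear_op_poly)
    then obtain K where K: "\<And>x. norm (op_poly q A x) \<le> norm x * K"
      using bounded_linear.bounded bounded_clinear_imp_bounded_linear by blast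
    show ?thesis
    proof (rule bounded_clinearI)
      fix x y
      have "(\<lambda>n. op_poly (p n) A (x + y)) \<longlonglongrightarrow> B x + B y"
        using linear_add[OF bounded_linear.linear[OF bounded_clinear_imp_bounded_linear[OF q_cl]]]
          tendsto_add[OF B[of x] B[of y]] by simp
      then show "B (x + y) = B x + B y" using B LIMSEQ_unique by blast
    next
      fix c x
      have "(\<lambda>n. c *\<^sub>C op_poly (p n) A x) \<longlonglongrightarrow> c *\<^sub>C B x"
        by (rule bounded_linear.tendsto[OF bounded_linear_scaleC B])
      then have "(\<lambda>n. op_poly (p n) A (c *\<^sub>C x)) \<longlonglongrightarrow> c *\<^sub>C B x"
        by (simp add: bounded_clinear_scaleC[OF q_cl])
      then show "B (c *\<^sub>C x) = c *\<^sub>C B x" using B LIMSEQ_unique by blast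
    next
      fix x
      have "norm (B x) \<le> norm (op_poly q A x) + norm (op_poly q A x - B x)"
        by (metis add.commute norm_minus_commute norm_triangle_sub)
      also have "\<dots> \<le> norm x * (K + 2)"
        using K[of x] close_B[OF q, of x] by (simp add: algebra_simps)
      finally show "norm (B x) \<le> norm x * (K + 2)" .
    qed
  qed
  have "(\<lambda>n. onorm (\<lambda>x. op_poly (q n) A x - B x)) \<longlonglongrightarrow> 0"
    if q: "uniform_limit {0..onorm A} (\<lambda>n. poly (q n)) f sequentially" for q :: "nat \<Rightarrow> real poly"
  proof (rule LIMSEQ_I)
    fix e :: real assume "0 < e"
    then have "0 < e / 4" by simp
    then obtain N where N: "\<And>n. N \<le> n \<Longrightarrow> close (e / 4) (q n)"
      using ev_close[OF q] unfolding eventually_sequentially by blast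
    have "norm (onorm (\<lambda>x. op_poly (q n) A x - B x) - 0) < e" if "N \<le> n" for n
    proof -
      have "onorm (\<lambda>x. op_poly (q n) A x - B x) \<le> 2 * (e / 4)"
        using close_B[OF N[OF that] \<open>0 < e / 4\<close>] \<open>0 < e\<close> by (intro onorm_bound) auto
      moreover have "0 \<le> onorm (\<lambda>x. op_poly (q n) A x - B x)"
        by (intro onorm_pos_le bounded_linear_sub bounded_linear_op_poly cl
            bounded_clinear_imp_bounded_linear B_cl)
      ultimately show ?thesis using \<open>0 < e\<close> by simp
    qed
    then show "\<exists>N. \<forall>n\<ge>N. norm (onorm (\<lambda>x. op_poly (q n) A x - B x) - 0) < e" by blast
  qed
  with B_cl show ?thesis by blast
qed

text \<open>Two candidates are both pointwise limits of the same approximating sequence, so they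
  coincide and the definite description in \<open>op_fun\<close> is attained.\<close>

lemma
  assumes A: "positive_op A" and f: "continuous_on {0..onorm A} f"
  shows bounded_clinear_op_fun: "bounded_clinear (op_fun f A)"
    and op_fun_tendsto: "uniform_limit {0..onorm A} (\<lambda>n. poly (p n)) f sequentially \<Longrightarrow>
      (\<lambda>n. op_poly (p n) A x) \<longlonglongrightarrow> op_fun f A x"
proof -
  let ?P = "\<lambda>B. bounded_clinear B \<and>
     (\<forall>p :: nat \<Rightarrow> real poly. uniform_limit {0..onorm A} (\<lambda>n. poly (p n)) f sequentially \<longrightarrow>
        (\<lambda>n. onorm (\<lambda>x. op_poly (p n) A x - B x)) \<longlonglongrightarrow> 0)"
  have lim: "(\<lambda>n. op_poly (p n) A x) \<longlonglongrightarrow> B x"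
    if "?P B" "uniform_limit {0..onorm A} (\<lambda>n. poly (p n)) f sequentially" for B p x
  proof (rule onorm_tendsto_0_imp_tendsto[where F = "\<lambda>n. op_poly (p n) A" and B = B])
    show "bounded_linear (op_poly (p n) A)" for n
      by (rule bounded_linear_op_poly[OF positive_op_imp_bounded_clinear[OF A]])
    show "bounded_linear B" using that(1) bounded_clinear_imp_bounded_linear by blast
    show "(\<lambda>n. onorm (\<lambda>x. op_poly (p n) A x - B x)) \<longlonglongrightarrow> 0" using that by blast
  qed
  obtain q where q: "uniform_limit {0..onorm A} (\<lambda>n. poly (q n)) f sequentially"
    using uniform_approx_poly[OF f] .
  have "\<exists>!B. ?P B"
  proof (rule ex_ex1I[OF op_fun_exists[OF A f]])
    fix B C assume "?P B" "?P C"
    from lim[OF this(1) q] lim[OF this(2) q] show "B = C"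
      by (intro ext) (rule LIMSEQ_unique)
  qed
  from theI'[OF this] have P: "?P (op_fun f A)" unfolding op_fun_def .
  then show "bounded_clinear (op_fun f A)" by (rule conjunct1)
  show "(\<lambda>n. op_poly (p n) A x) \<longlonglongrightarrow> op_fun f A x"
    if "uniform_limit {0..onorm A} (\<lambda>n. poly (p n)) f sequentially"
    by (rule lim[OF P that])
qed

text \<open>The definition sees \<open>f\<close> only through uniform convergence on the interval.
  Identities valid only for nonnegative arguments, such as \<open>sqrt s * sqrt s = s\<close>, can
  therefore be used.\<close>

lemma op_fun_cong:
  assumes "\<And>s. s \<in> {0..onorm A} \<Longrightarrow> f s = g s"
  shows "op_fun f A = op_fun g A"
proof -
  have "uniform_limit {0..onorm A} F f sequentially = uniform_limit {0..onorm A} F g sequentially"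
    for F :: "nat \<Rightarrow> real \<Rightarrow> real"
    by (rule uniform_limit_cong') (use assms in auto)
  then show ?thesis by (simp only: op_fun_def)
qed

section \<open>Laws of the functional calculus\<close>

lemma op_fun_poly:
  assumes A: "positive_op A"
  shows "op_fun (poly p) A = op_poly p A"
proof
  fix x
  have "(\<lambda>n. op_poly p A x) \<longlonglongrightarrow> op_fun (poly p) A x"
    by (rule op_fun_tendsto[OF A]) (auto intro: continuous_intros uniform_limit_const)
  then show "op_fun (poly p) A x = op_poly p A x" by (simp add: LIMSEQ_const_iff)
qed

lemma op_fun_ident:
  assumes A: "positive_op A"
  shows "op_fun (\<lambda>s. s) A = A"
proof -
  interpret bounded_linear A using A by (rule positive_op_imp_bounded_linear)
  have "op_fun (\<lambda>s. s) A = op_fun (poly [:0, 1:]) A" by (rule op_fun_cong) simp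
  also have "\<dots> = A" unfolding op_fun_poly[OF A]
    by (rule ext) (simp add: op_poly_pCons bounded_linear_axioms zero)
  finally show ?thesis .
qed

lemma op_fun_const:
  assumes A: "positive_op A"
  shows "op_fun (\<lambda>s. c) A x = c *\<^sub>R x"
proof -
  have "op_fun (\<lambda>s. c) A = op_fun (poly [:c:]) A" by (rule op_fun_cong) simp
  then show ?thesis by (simp add: op_fun_poly[OF A])
qed

lemma op_fun_selfadjoint:
  assumes A: "positive_op A" and f: "continuous_on {0..onorm A} f"
  shows "cinner (op_fun f A x) y = cinner x (op_fun f A y)"
proof -
  obtain p where p: "uniform_limit {0..onorm A} (\<lambda>n. poly (p n)) f sequentially"
    using uniform_approx_poly[OF f] .
  note lim = op_fun_tendsto[OF A f p]
  have "(\<lambda>n. cinner (op_poly (p n) A x) y) \<longlonglongrightarrow> cinner (op_fun f A x) y"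
    by (intro cinner.tendsto lim tendsto_const)
  moreover have "(\<lambda>n. cinner (op_poly (p n) A x) y) \<longlonglongrightarrow> cinner x (op_fun f A y)"
    unfolding op_poly_selfadjoint[OF A] by (intro cinner.tendsto lim tendsto_const)
  ultimately show ?thesis by (rule LIMSEQ_unique)
qed

lemma op_fun_add:
  assumes A: "positive_op A" and f: "continuous_on {0..onorm A} f" and g: "continuous_on {0..onorm A} g"
  shows "op_fun (\<lambda>s. f s + g s) A x = op_fun f A x + op_fun g A x"
proof -
  obtain p where p: "uniform_limit {0..onorm A} (\<lambda>n. poly (p n)) f sequentially"
    using uniform_approx_poly[OF f] .
  obtain q where q: "uniform_limit {0..onorm A} (\<lambda>n. poly (q n)) g sequentially"
    using uniform_approx_poly[OF g] .
  have "uniform_limit {0..onorm A} (\<lambda>n. poly (p n + q n)) (\<lambda>s. f s + g s) sequentially"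
  proof -
    have "poly (p n + q n) = (\<lambda>s. poly (p n) s + poly (q n) s)" for n by auto
    then show ?thesis using uniform_limit_add[OF p q] by simp
  qed
  then have "(\<lambda>n. op_poly (p n + q n) A x) \<longlonglongrightarrow> op_fun (\<lambda>s. f s + g s) A x"
    by (intro op_fun_tendsto A continuous_on_add f g)
  moreover have "(\<lambda>n. op_poly (p n + q n) A x) \<longlonglongrightarrow> op_fun f A x + op_fun g A x"
    unfolding op_poly_add by (intro tendsto_add op_fun_tendsto A f g p q)
  ultimately show ?thesis by (rule LIMSEQ_unique)
qed

text \<open>The identity is tested against a vector \<open>y\<close>. Moving
  \<open>op_poly (p n) A\<close> onto \<open>y\<close> leaves one convergent sequence in each
  argument of the inner product, so joint continuity of \<open>cinner\<close> gives the
  limit.\<close>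

lemma op_fun_mult:
  assumes A: "positive_op A" and f: "continuous_on {0..onorm A} f" and g: "continuous_on {0..onorm A} g"
  shows "op_fun (\<lambda>s. f s * g s) A x = op_fun f A (op_fun g A x)"
proof (rule cinner_left_ext)
  fix y
  obtain p where p: "uniform_limit {0..onorm A} (\<lambda>n. poly (p n)) f sequentially"
    using uniform_approx_poly[OF f] .
  obtain q where q: "uniform_limit {0..onorm A} (\<lambda>n. poly (q n)) g sequentially"
    using uniform_approx_poly[OF g] .
  have "uniform_limit {0..onorm A} (\<lambda>n. poly (p n * q n)) (\<lambda>s. f s * g s) sequentially"
  proof -
    have "poly (p n * q n) = (\<lambda>s. poly (p n) s * poly (q n) s)" for n by auto
    moreover have "uniform_limit {0..onorm A} (\<lambda>n s. poly (p n) s * poly (q n) s) (\<lambda>s. f s * g s) sequentially"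
      by (intro uniform_lim_mult p q compact_imp_bounded compact_continuous_image f g compact_Icc)
    ultimately show ?thesis by simp
  qed
  then have "(\<lambda>n. op_poly (p n * q n) A x) \<longlonglongrightarrow> op_fun (\<lambda>s. f s * g s) A x"
    by (intro op_fun_tendsto A continuous_on_mult f g)
  then have "(\<lambda>n. cinner (op_poly (p n * q n) A x) y) \<longlonglongrightarrow> cinner (op_fun (\<lambda>s. f s * g s) A x) y"
    by (intro cinner.tendsto tendsto_const)
  moreover have "(\<lambda>n. cinner (op_poly (q n) A x) (op_poly (p n) A y))
      \<longlonglongrightarrow> cinner (op_fun g A x) (op_fun f A y)"
    by (intro cinner.tendsto op_fun_tendsto A f g p q)
  ultimately show "cinner (op_fun (\<lambda>s. f s * g s) A x) y = cinner (op_fun f A (op_fun g A x)) y"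
    unfolding op_poly_mult[OF positive_op_imp_bounded_clinear[OF A]] op_poly_selfadjoint[OF A]
      op_fun_selfadjoint[OF A f] by (rule LIMSEQ_unique)
qed

lemma op_fun_commute:
  assumes A: "positive_op A" and f: "continuous_on {0..onorm A} f"
    and B: "bounded_linear B" "\<And>x. A (B x) = B (A x)"
  shows "op_fun f A (B x) = B (op_fun f A x)"
proof -
  obtain p where p: "uniform_limit {0..onorm A} (\<lambda>n. poly (p n)) f sequentially"
    using uniform_approx_poly[OF f] .
  have "(\<lambda>n. op_poly (p n) A (B x)) \<longlonglongrightarrow> op_fun f A (B x)"
    by (rule op_fun_tendsto[OF A f p])
  moreover have "(\<lambda>n. op_poly (p n) A (B x)) \<longlonglongrightarrow> B (op_fun f A x)"
    unfolding op_poly_commute[OF positive_op_imp_bounded_clinear[OF A] B]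
    by (intro bounded_linear.tendsto[OF B(1)] op_fun_tendsto[OF A f p])
  ultimately show ?thesis by (rule LIMSEQ_unique)
qed

lemma op_fun_power2_norm:
  assumes A: "positive_op A" and f: "continuous_on {0..onorm A} f"
  shows "(norm (op_fun f A x))\<^sup>2 = Re (cinner (op_fun (\<lambda>s. (f s)\<^sup>2) A x) x)"
  unfolding power2_eq_square[of "f _"] op_fun_mult[OF A f f]
  by (simp add: power2_norm_eq_cinner op_fun_selfadjoint[OF A f, of "op_fun f A x" x])

text \<open>The gap in the pointwise inequality is the square of the continuous function
  \<open>k\<close>, so the two sides differ exactly by the squared norm of
  \<open>op_fun k A x\<close>.\<close>

lemma op_fun_power2_norm_le:
  assumes A: "positive_op A" and f: "continuous_on {0..onorm A} f" and g: "continuous_on {0..onorm A} g"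
    and h: "continuous_on {0..onorm A} h"
    and le: "\<And>s. s \<in> {0..onorm A} \<Longrightarrow> (f s)\<^sup>2 + (g s)\<^sup>2 \<le> (h s)\<^sup>2"
  shows "(norm (op_fun f A x))\<^sup>2 + (norm (op_fun g A x))\<^sup>2 \<le> (norm (op_fun h A x))\<^sup>2"
proof -
  define k where "k = (\<lambda>s. sqrt ((h s)\<^sup>2 - ((f s)\<^sup>2 + (g s)\<^sup>2)))"
  have k: "continuous_on {0..onorm A} k"
    unfolding k_def by (intro continuous_intros f g h)
  have "op_fun (\<lambda>s. (h s)\<^sup>2) A = op_fun (\<lambda>s. ((f s)\<^sup>2 + (g s)\<^sup>2) + (k s)\<^sup>2) A"
    by (rule op_fun_cong) (simp add: k_def le)
  then have "op_fun (\<lambda>s. (h s)\<^sup>2) A x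
      = op_fun (\<lambda>s. (f s)\<^sup>2) A x + op_fun (\<lambda>s. (g s)\<^sup>2) A x + op_fun (\<lambda>s. (k s)\<^sup>2) A x"
    using A f g k by (simp add: op_fun_add continuous_intros)
  then have "(norm (op_fun h A x))\<^sup>2
      = (norm (op_fun f A x))\<^sup>2 + (norm (op_fun g A x))\<^sup>2 + (norm (op_fun k A x))\<^sup>2"
    by (simp add: op_fun_power2_norm[OF A] f g h k cinner_add_left)
  then show ?thesis by simp
qed

lemma op_fun_norm_mono:
  assumes A: "positive_op A" and f: "continuous_on {0..onorm A} f" and h: "continuous_on {0..onorm A} h"
    and le: "\<And>s. s \<in> {0..onorm A} \<Longrightarrow> \<bar>f s\<bar> \<le> \<bar>h s\<bar>"
  shows "norm (op_fun f A x) \<le> norm (op_fun h A x)"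
proof -
  have "(norm (op_fun f A x))\<^sup>2 + (norm (op_fun (\<lambda>s. 0) A x))\<^sup>2 \<le> (norm (op_fun h A x))\<^sup>2"
    by (intro op_fun_power2_norm_le A f h continuous_on_const) (simp add: le abs_le_square_iff[symmetric])
  then have "(norm (op_fun f A x))\<^sup>2 \<le> (norm (op_fun h A x))\<^sup>2"
    by (simp add: op_fun_const[OF A])
  then show ?thesis by (rule power2_le_imp_le) simp
qed

text \<open>Writing \<open>f\<close> as the square of \<open>sqrt (f s)\<close> turns the quadratic
  form into a squared norm.\<close>

lemma positive_op_op_fun:
  assumes A: "positive_op A" and f: "continuous_on {0..onorm A} f"
    and nonneg: "\<And>s. s \<in> {0..onorm A} \<Longrightarrow> 0 \<le> f s"
  shows "positive_op (op_fun f A)"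
proof (rule positive_opI)
  have "op_fun f A = op_fun (\<lambda>s. (sqrt (f s))\<^sup>2) A"
    by (rule op_fun_cong) (simp add: nonneg)
  then show "0 \<le> Re (cinner (op_fun f A x) x)" for x
    using op_fun_power2_norm[OF A continuous_on_real_sqrt[OF f], of x]
      zero_le_power2[of "norm (op_fun (\<lambda>s. sqrt (f s)) A x)"] by (simp only:)
qed (rule bounded_clinear_op_fun[OF A f] op_fun_selfadjoint[OF A f])+

section \<open>Square roots of positive operators\<close>

lemma op_fun_sqrt:
  assumes A: "positive_op A"
  shows "positive_op (op_fun sqrt A)" "op_fun sqrt A (op_fun sqrt A x) = A x"
proof -
  have c: "continuous_on {0..onorm A} sqrt" by (intro continuous_intros)
  show "positive_op (op_fun sqrt A)" by (rule positive_op_op_fun[OF A c]) simp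
  have "op_fun (\<lambda>s. sqrt s * sqrt s) A = op_fun (\<lambda>s. s) A" by (rule op_fun_cong) simp
  then show "op_fun sqrt A (op_fun sqrt A x) = A x"
    by (simp add: op_fun_mult[OF A c c, symmetric] op_fun_ident[OF A])
qed

text \<open>The quadratic form of \<open>B\<close> at \<open>x\<close> is the squared norm of
  \<open>?C x\<close>, and \<open>B\<close> factors through \<open>?C\<close>.\<close>

lemma positive_op_eq_0:
  assumes B: "positive_op B" and "Re (cinner (B x) x) = 0"
  shows "B x = 0"
proof -
  let ?C = "op_fun sqrt B"
  have "(norm (?C x))\<^sup>2 = Re (cinner (?C (?C x)) x)"
    by (simp add: power2_norm_eq_cinner positive_op_selfadjoint[OF op_fun_sqrt(1)[OF B], of _ x])
  then have "?C x = 0" using assms by (simp add: op_fun_sqrt(2))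
  then have "B x = ?C 0" using op_fun_sqrt(2)[OF B, of x] by simp
  then show ?thesis
    using linear_0[OF bounded_linear.linear[OF positive_op_imp_bounded_linear[OF op_fun_sqrt(1)[OF B]]]]
    by simp
qed

text \<open>With \<open>y = B x - C x\<close>, commutation gives \<open>B y + C y = 0\<close>. Both
  quadratic forms at \<open>y\<close> are nonnegative with sum zero, so \<open>B y\<close> and
  \<open>C y\<close> vanish, and moving \<open>B\<close> and \<open>C\<close> across the inner
  product yields \<open>cinner y y = 0\<close>.\<close>

lemma positive_sqrt_unique:
  assumes A: "positive_op A" and B: "positive_op B" "B \<circ> B = A"
  shows "B = op_fun sqrt A"
proof
  fix x
  define C where "C = op_fun sqrt A"
  have C: "positive_op C" "\<And>x. C (C x) = A x" using op_fun_sqrt[OF A] by (auto simp: C_def)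
  interpret B: bounded_linear B using B(1) by (rule positive_op_imp_bounded_linear)
  interpret C: bounded_linear C using C(1) by (rule positive_op_imp_bounded_linear)
  have BB: "B (B x) = A x" for x using B(2) by (auto simp: fun_eq_iff)
  \<comment> \<open>\<open>B\<close> commutes with its own square \<open>A\<close>, hence with every
    continuous function of \<open>A\<close>.\<close>
  have CB: "C (B x) = B (C x)" for x
    unfolding C_def using BB
    by (intro op_fun_commute[OF A _ B.bounded_linear_axioms] continuous_intros) metis
  define y where "y = B x - C x"
  have "B y + C y = 0" by (simp add: y_def B.diff C.diff BB C(2) CB)
  then have "Re (cinner (B y) y) + Re (cinner (C y) y) = 0"
    by (metis cinner_add_left cinner.zero_left plus_complex.sel(1) zero_complex.sel(1))
  then have "Re (cinner (B y) y) = 0" "Re (cinner (C y) y) = 0"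
    using positive_op_Re_cinner[OF B(1), of y] positive_op_Re_cinner[OF C(1), of y] by linarith+
  then have "B y = 0" "C y = 0"
    using positive_op_eq_0[OF B(1)] positive_op_eq_0[OF C(1)] by blast+
  have "cinner y y = cinner x (B y) - cinner x (C y)"
    by (simp add: y_def cinner.diff_left positive_op_selfadjoint[OF B(1), of x]
        positive_op_selfadjoint[OF C(1), of x])
  then have "y = 0" using \<open>B y = 0\<close> \<open>C y = 0\<close> by (simp add: cinner.zero_right cinner_self)
  then show "B x = op_fun sqrt A x" by (simp add: y_def C_def)
qed

lemma op_sqrt_eq_op_fun:
  assumes A: "positive_op A"
  shows "op_sqrt A = op_fun sqrt A"
  unfolding op_sqrt_def
  by (rule the_equality) (auto simp: op_fun_sqrt[OF A] positive_sqrt_unique[OF A])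

section \<open>Powers of positive operators\<close>

lemma continuous_on_powr_const: "0 < t \<Longrightarrow> continuous_on {0..b::real} (\<lambda>s. s powr t)"
  by (intro continuous_on_powr' continuous_intros) auto

lemma bounded_clinear_op_powr: "positive_op A \<Longrightarrow> 0 \<le> t \<Longrightarrow> bounded_clinear (op_powr A t)"
  by (auto simp: op_powr_def bounded_clinear_id intro!: bounded_clinear_op_fun continuous_on_powr_const)

lemma op_powr_selfadjoint:
  "positive_op A \<Longrightarrow> 0 \<le> t \<Longrightarrow> cinner (op_powr A t x) y = cinner x (op_powr A t y)"
  by (auto simp: op_powr_def intro!: op_fun_selfadjoint continuous_on_powr_const)

lemma op_powr_1:
  assumes "positive_op A"
  shows "op_powr A 1 = A"
proof -
  have "op_powr A 1 = op_fun (\<lambda>s. s) A"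
    using op_fun_cong[of A "\<lambda>s. s powr 1" "\<lambda>s. s"] by (simp add: op_powr_def)
  then show ?thesis by (simp only: op_fun_ident[OF assms])
qed

text \<open>Exponent zero is treated apart: there the power is the identity, while
  \<open>r powr 0\<close> vanishes at \<open>r = 0\<close>.\<close>

lemma op_powr_add:
  assumes A: "positive_op A" and "0 \<le> s" "0 \<le> t"
  shows "op_powr A s (op_powr A t x) = op_powr A (s + t) x"
proof (cases "s = 0 \<or> t = 0")
  case False
  with assms have "0 < s" "0 < t" by auto
  then have "op_powr A s (op_powr A t x) = op_fun (\<lambda>r. r powr s * r powr t) A x"
    by (simp add: op_powr_def op_fun_mult[OF A] continuous_on_powr_const)
  then show ?thesis
    using \<open>0 < s\<close> \<open>0 < t\<close> by (simp add: op_powr_def powr_add)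
qed (auto simp: op_powr_def)

section \<open>The spherical polar decomposition\<close>

lemma bounded_clinear_lim:
  assumes F: "\<And>n::nat. bounded_clinear (F n)" and lim: "\<And>x. (\<lambda>n. F n x) \<longlonglongrightarrow> B x"
    and K: "\<And>n x. norm (F n x) \<le> K * norm x"
  shows "bounded_clinear B"
proof (rule bounded_clinearI)
  fix x y
  have "(\<lambda>n. F n (x + y)) \<longlonglongrightarrow> B x + B y"
    using linear_add[OF bounded_linear.linear[OF bounded_clinear_imp_bounded_linear[OF F]]]
      tendsto_add[OF lim[of x] lim[of y]] by simp
  then show "B (x + y) = B x + B y" using lim LIMSEQ_unique by blast
next
  fix c x
  have "(\<lambda>n. c *\<^sub>C F n x) \<longlonglongrightarrow> c *\<^sub>C B x"
    by (rule bounded_linear.tendsto[OF bounded_linear_scaleC lim])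
  then have "(\<lambda>n. F n (c *\<^sub>C x)) \<longlonglongrightarrow> c *\<^sub>C B x"
    by (simp add: bounded_clinear_scaleC[OF F])
  then show "B (c *\<^sub>C x) = c *\<^sub>C B x" using lim LIMSEQ_unique by blast
next
  fix x
  show "norm (B x) \<le> norm x * K"
  proof (rule tendsto_upperbound)
    show "(\<lambda>n. norm (F n x)) \<longlonglongrightarrow> norm (B x)" by (intro tendsto_norm lim)
    show "\<forall>\<^sub>F n in sequentially. norm (F n x) \<le> norm x * K"
      using K[of _ x] by (simp add: mult.commute)
  qed simp
qed

text \<open>
  The polar factor \<open>V\<^sub>i\<close> is obtained as the strong limit of \<open>T\<^sub>i (P + 1/n)\<^bsup>-1\<^esup>\<close>, so no orthogonal
  projections and no extension by continuity from the range of \<open>P\<close> are needed.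
\<close>

definition reg_eps :: "nat \<Rightarrow> real" where
  "reg_eps n = inverse (real (Suc n))"

lemma reg_eps_pos: "0 < reg_eps n"
  by (simp add: reg_eps_def)

lemma reg_eps_antimono: "n \<le> m \<Longrightarrow> reg_eps m \<le> reg_eps n"
  by (simp add: reg_eps_def)

lemma reg_eps_tendsto: "reg_eps \<longlonglongrightarrow> 0"
  unfolding reg_eps_def by (rule LIMSEQ_inverse_real_of_nat)

text \<open>The resolvent of a positive operator at the negative point
  \<open>- reg_eps n\<close>.\<close>

definition reg_inverse :: "('a::chilbert_space \<Rightarrow> 'a) \<Rightarrow> nat \<Rightarrow> 'a \<Rightarrow> 'a" where
  "reg_inverse A n = op_fun (\<lambda>s. inverse (s + reg_eps n)) A"

section \<open>Convergence of the regularized inverses\<close>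

context
  fixes A :: "'a::chilbert_space \<Rightarrow> 'a"
  assumes A: "positive_op A"
begin

text \<open>The function of \<open>A\<close> that represents
  \<open>A \<circ> reg_inverse A n\<close>. On nonnegative arguments it increases with
  \<open>n\<close> to the indicator function of the positive half-line.\<close>

private abbreviation ramp :: "nat \<Rightarrow> real \<Rightarrow> real" where
  "ramp n \<equiv> \<lambda>s. s * inverse (s + reg_eps n)"

private lemma add_reg_eps_pos: "0 \<le> s \<Longrightarrow> 0 < s + reg_eps n"
  using reg_eps_pos[of n] by linarith

private lemma continuous_reg: "continuous_on {0..onorm A} (\<lambda>s. inverse (s + reg_eps n))"
proof (intro continuous_intros ballI)
  fix s assume "s \<in> {0..onorm A}"
  then show "s + reg_eps n \<noteq> 0" using add_reg_eps_pos[of s n] by simp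
qed

private lemma continuous_ramp: "continuous_on {0..onorm A} (ramp n)"
  by (intro continuous_on_mult continuous_on_id continuous_reg)

private lemma ramp_bounds:
  assumes "0 \<le> s"
  shows "0 \<le> ramp n s" "ramp n s \<le> 1"
  using add_reg_eps_pos[OF assms, of n] reg_eps_pos[of n] assms
  by (simp_all add: field_simps)

private lemma ramp_mono:
  assumes "0 \<le> s" "n \<le> m"
  shows "ramp n s \<le> ramp m s"
  using add_reg_eps_pos[OF assms(1), of m] reg_eps_antimono[OF assms(2)] assms(1)
  by (intro mult_left_mono le_imp_inverse_le) simp_all

private lemma ramp_near_id:
  assumes "0 \<le> s"
  shows "\<bar>s - s * ramp n s\<bar> \<le> reg_eps n"
proof -
  have "s - s * ramp n s = reg_eps n * ramp n s"
    using add_reg_eps_pos[OF assms, of n] by (simp add: field_simps)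
  moreover have "0 \<le> reg_eps n * ramp n s"
    using less_imp_le[OF reg_eps_pos] ramp_bounds(1)[OF assms] by (rule mult_nonneg_nonneg)
  moreover have "reg_eps n * ramp n s \<le> reg_eps n"
    using ramp_bounds(2)[OF assms] less_imp_le[OF reg_eps_pos] by (rule mult_left_le)
  ultimately show ?thesis by (simp only: abs_of_nonneg)
qed

lemma bounded_clinear_reg_inverse: "bounded_clinear (reg_inverse A n)"
  unfolding reg_inverse_def by (rule bounded_clinear_op_fun[OF A continuous_reg])

private lemma ramp_eq: "op_fun (ramp n) A x = A (reg_inverse A n x)"
  using op_fun_mult[OF A continuous_on_id continuous_reg, of n x]
  by (simp add: reg_inverse_def op_fun_ident[OF A])

lemma reg_inverse_commute: "reg_inverse A n (A x) = A (reg_inverse A n x)"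
  unfolding reg_inverse_def
  by (rule op_fun_commute[OF A continuous_reg positive_op_imp_bounded_linear[OF A]]) simp

lemma norm_reg_inverse_le: "norm (A (reg_inverse A n x)) \<le> norm x"
proof -
  have "norm (op_fun (ramp n) A x) \<le> norm (op_fun (\<lambda>s. 1) A x)"
    using ramp_bounds[of _ n]
    by (intro op_fun_norm_mono[OF A continuous_ramp]) auto
  then show ?thesis by (simp only: ramp_eq op_fun_const[OF A] scaleR_one)
qed

text \<open>On the interval, \<open>s * ramp n s\<close> lies within \<open>reg_eps n\<close> of
  \<open>s\<close>, so the corresponding operators differ by at most that much in norm.\<close>

lemma reg_inverse_tendsto: "(\<lambda>n. A (reg_inverse A n (A x))) \<longlonglongrightarrow> A x"
proof -
  have "norm (A (reg_inverse A n (A x)) - A x) \<le> reg_eps n * norm x" for n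
  proof -
    let ?k = "\<lambda>s. s - s * ramp n s"
    have k: "continuous_on {0..onorm A} ?k"
      by (intro continuous_on_diff continuous_on_id continuous_on_mult continuous_reg)
    have sr: "continuous_on {0..onorm A} (\<lambda>s. ramp n s * s)"
      by (intro continuous_on_mult continuous_ramp continuous_on_id)
    have "op_fun (\<lambda>s. s) A = op_fun (\<lambda>s. ?k s + ramp n s * s) A"
      by (rule op_fun_cong) simp
    then have "op_fun (\<lambda>s. s) A x = op_fun ?k A x + op_fun (\<lambda>s. ramp n s * s) A x"
      unfolding op_fun_add[OF A k sr, symmetric] by (rule fun_cong)
    then have "A x = op_fun ?k A x + op_fun (\<lambda>s. ramp n s * s) A x"
      by (simp only: op_fun_ident[OF A])
    also have "op_fun (\<lambda>s. ramp n s * s) A x = A (reg_inverse A n (A x))"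
      by (simp only: op_fun_mult[OF A continuous_ramp continuous_on_id] op_fun_ident[OF A] ramp_eq)
    finally have "norm (A (reg_inverse A n (A x)) - A x) = norm (op_fun ?k A x)"
      by (metis add_diff_cancel_right' norm_minus_commute)
    also have "\<dots> \<le> norm (op_fun (\<lambda>s. reg_eps n) A x)"
    proof (rule op_fun_norm_mono[OF A k continuous_on_const])
      fix s assume "s \<in> {0..onorm A}"
      then have "0 \<le> s" by simp
      from ramp_near_id[OF this, of n] show "\<bar>?k s\<bar> \<le> \<bar>reg_eps n\<bar>"
        using reg_eps_pos[of n] by linarith
    qed
    finally show ?thesis using reg_eps_pos[of n] by (simp add: op_fun_const[OF A])
  qed
  then have "\<forall>n. norm (A (reg_inverse A n (A x)) - A x) \<le> reg_eps n * norm x" by blast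
  then have "(\<lambda>n. A (reg_inverse A n (A x)) - A x) \<longlonglongrightarrow> 0"
    by (rule Lim_null_comparison[OF always_eventually tendsto_mult_left_zero[OF reg_eps_tendsto]])
  then show ?thesis by (rule LIM_zero_cancel)
qed

text \<open>Monotonicity of the ramps bounds the squared distance of two terms by the increment of
  the squared norms \<open>a\<close>. These increase and are bounded, so the sequence of vectors is
  Cauchy.\<close>

lemma convergent_reg_inverse: "convergent (\<lambda>n. A (reg_inverse A n x))"
proof -
  define a where "a = (\<lambda>n. (norm (A (reg_inverse A n x)))\<^sup>2)"
  have dist: "(norm (A (reg_inverse A m x) - A (reg_inverse A n x)))\<^sup>2 \<le> a m - a n" if "n \<le> m" for m n
  proof -
    let ?k = "\<lambda>s. ramp m s - ramp n s"
    have k: "continuous_on {0..onorm A} ?k"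
      by (intro continuous_on_diff continuous_ramp)
    have "op_fun (ramp m) A = op_fun (\<lambda>s. ?k s + ramp n s) A"
      by (rule op_fun_cong) simp
    then have "op_fun (ramp m) A x = op_fun ?k A x + op_fun (ramp n) A x"
      unfolding op_fun_add[OF A k continuous_ramp, symmetric] by (rule fun_cong)
    moreover have "(norm (op_fun ?k A x))\<^sup>2 + (norm (op_fun (ramp n) A x))\<^sup>2 \<le> (norm (op_fun (ramp m) A x))\<^sup>2"
    proof (rule op_fun_power2_norm_le[OF A k continuous_ramp continuous_ramp])
      fix s assume "s \<in> {0..onorm A}"
      then have s: "0 \<le> s" by simp
      have le: "(b - a)\<^sup>2 + a\<^sup>2 \<le> b\<^sup>2" if "0 \<le> a" "a \<le> b" for a b :: real
      proof -
        have "0 \<le> a * (b - a)" using that by simp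
        then show ?thesis by (simp add: power2_eq_square algebra_simps)
      qed
      show "(?k s)\<^sup>2 + (ramp n s)\<^sup>2 \<le> (ramp m s)\<^sup>2"
        by (rule le[OF ramp_bounds(1)[OF s] ramp_mono[OF s that]])
    qed
    ultimately show ?thesis unfolding a_def by (simp add: ramp_eq)
  qed
  have "incseq a"
  proof (rule monoI)
    fix n m :: nat assume "n \<le> m"
    then show "a n \<le> a m"
      using dist[of n m] zero_le_power2[of "norm (A (reg_inverse A m x) - A (reg_inverse A n x))"] by linarith
  qed
  moreover have "a n \<le> (norm x)\<^sup>2" for n
    unfolding a_def by (intro power_mono norm_reg_inverse_le) simp
  ultimately have "Cauchy a"
    using incseq_convergent[of a "(norm x)\<^sup>2"] convergent_Cauchy convergent_def by metis
  have "Cauchy (\<lambda>n. A (reg_inverse A n x))"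
  proof (rule CauchyI')
    fix e :: real assume "0 < e"
    then have "0 < e\<^sup>2" by simp
    with \<open>Cauchy a\<close> obtain N where N: "\<And>m n. N \<le> m \<Longrightarrow> N \<le> n \<Longrightarrow> norm (a m - a n) < e\<^sup>2"
      unfolding Cauchy_iff by meson
    have "norm (A (reg_inverse A m x) - A (reg_inverse A n x)) < e" if "N \<le> m" "m < n" for m n
    proof (rule power2_less_imp_less)
      have "(norm (A (reg_inverse A m x) - A (reg_inverse A n x)))\<^sup>2 \<le> a n - a m"
        using dist[of m n] that by (simp add: norm_minus_commute)
      also have "\<dots> < e\<^sup>2" using N[of n m] that by simp
      finally show "(norm (A (reg_inverse A m x) - A (reg_inverse A n x)))\<^sup>2 < e\<^sup>2" .
    qed (use \<open>0 < e\<close> in simp)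
    then show "\<exists>N. \<forall>m\<ge>N. \<forall>n>m. dist (A (reg_inverse A m x)) (A (reg_inverse A n x)) < e"
      unfolding dist_norm by blast
  qed
  then show ?thesis by (rule Cauchy_convergent)
qed

text \<open>Applying \<open>A\<close> to the sequence shows \<open>A q = A x\<close>. Thus
  \<open>x\<close> splits into \<open>q\<close>, a limit of vectors in the range of
  \<open>A\<close>, and \<open>x - q\<close> in its kernel.\<close>

lemma reg_inverse_limit_kernel:
  assumes "(\<lambda>n. A (reg_inverse A n x)) \<longlonglongrightarrow> q"
  shows "A (x - q) = 0"
proof -
  interpret A: bounded_linear A using A by (rule positive_op_imp_bounded_linear)
  have "(\<lambda>n. A (A (reg_inverse A n x))) \<longlonglongrightarrow> A q"
    by (rule A.tendsto[OF assms])
  moreover have "(\<lambda>n. A (A (reg_inverse A n x))) \<longlonglongrightarrow> A x"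
    using reg_inverse_tendsto[of x] by (simp only: reg_inverse_commute)
  ultimately have "A q = A x" by (rule LIMSEQ_unique)
  then show ?thesis by (simp add: A.diff)
qed

lemma eq_on_range_kernel:
  assumes B: "bounded_linear B" and C: "bounded_linear C"
    and ran: "\<And>x. B (A x) = C (A x)" and ker: "\<And>x. A x = 0 \<Longrightarrow> B x = C x"
  shows "B x = C x"
proof -
  obtain q where q: "(\<lambda>n. A (reg_inverse A n x)) \<longlonglongrightarrow> q"
    using convergent_reg_inverse convergent_def by blast
  have "B q = C q"
    using bounded_linear.tendsto[OF B q, unfolded ran] bounded_linear.tendsto[OF C q]
    by (rule LIMSEQ_unique)
  moreover have "B (x - q) = C (x - q)" by (rule ker[OF reg_inverse_limit_kernel[OF q]])
  ultimately show ?thesis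
    by (simp add: linear_diff[OF bounded_linear.linear[OF B]] linear_diff[OF bounded_linear.linear[OF C]])
qed

end

section \<open>Modulus and polar factor of a tuple\<close>

context
  fixes T :: "'d::finite \<Rightarrow> 'a::chilbert_space \<Rightarrow> 'a"
  assumes T: "\<And>i. bounded_clinear (T i)"
begin

private abbreviation "P \<equiv> sph_modulus T"

lemma positive_op_sum_cadjoint: "positive_op (\<lambda>x. \<Sum>i\<in>UNIV. cadjoint (T i) (T i x))"
  and cinner_sum_cadjoint:
    "cinner (\<Sum>i\<in>UNIV. cadjoint (T i) (T i x)) y = (\<Sum>i\<in>UNIV. cinner (T i x) (T i y))"
proof -
  let ?G = "\<lambda>x. \<Sum>i\<in>UNIV. cadjoint (T i) (T i x)"
  have adj: "cinner (cadjoint (T i) x) y = cinner x (T i y)" for i x y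
    by (metis cinner_cadjoint[OF T] cinner_commute)
  have *: "cinner (?G x) y = (\<Sum>i\<in>UNIV. cinner (T i x) (T i y))" for x y
    by (simp add: cinner.sum_left adj)
  then show "cinner (\<Sum>i\<in>UNIV. cadjoint (T i) (T i x)) y = (\<Sum>i\<in>UNIV. cinner (T i x) (T i y))" .
  show "positive_op ?G"
  proof (rule positive_opI)
    have "bounded_linear ?G"
      by (rule bounded_linear_sum)
        (rule bounded_linear_compose[OF bounded_clinear_imp_bounded_linear[OF bounded_clinear_cadjoint[OF T]]
          bounded_clinear_imp_bounded_linear[OF T]])
    moreover have "?G (k *\<^sub>C x) = k *\<^sub>C ?G x" for k x
      by (simp add: bounded_clinear_scaleC[OF T] bounded_clinear_scaleC[OF bounded_clinear_cadjoint[OF T]]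
          complex_vector.scale_sum_right)
    ultimately show "bounded_clinear ?G" unfolding bounded_clinear_def by blast
    show "cinner (?G x) y = cinner x (?G y)" for x y
    proof -
      have "cinner x (?G y) = cnj (cinner (?G y) x)" by (rule cinner_commute)
      also have "\<dots> = (\<Sum>i\<in>UNIV. cinner (T i x) (T i y))"
        unfolding * cnj_sum by (intro sum.cong refl cinner_commute[symmetric])
      finally show ?thesis by (simp only: *)
    qed
    show "0 \<le> Re (cinner (?G x) x)" for x
      unfolding * cinner_self Re_sum by (rule sum_nonneg) simp
  qed
qed

lemma positive_op_sph_modulus: "positive_op P"
  unfolding sph_modulus_def op_sqrt_eq_op_fun[OF positive_op_sum_cadjoint]
  by (rule op_fun_sqrt(1)[OF positive_op_sum_cadjoint])

lemma norm_sph_modulus: "(norm (P x))\<^sup>2 = (\<Sum>i\<in>UNIV. (norm (T i x))\<^sup>2)"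
proof -
  have "P (P x) = (\<Sum>i\<in>UNIV. cadjoint (T i) (T i x))"
    unfolding sph_modulus_def op_sqrt_eq_op_fun[OF positive_op_sum_cadjoint]
    by (rule op_fun_sqrt(2)[OF positive_op_sum_cadjoint])
  then have "(norm (P x))\<^sup>2 = Re (cinner (\<Sum>i\<in>UNIV. cadjoint (T i) (T i x)) x)"
    by (simp add: power2_norm_eq_cinner positive_op_selfadjoint[OF positive_op_sph_modulus, of "P x" x, symmetric])
  then show ?thesis by (simp add: cinner_sum_cadjoint cinner_self)
qed

lemma norm_le_norm_sph_modulus: "norm (T i x) \<le> norm (P x)"
proof (rule power2_le_imp_le)
  show "(norm (T i x))\<^sup>2 \<le> (norm (P x))\<^sup>2"
    unfolding norm_sph_modulus by (rule member_le_sum) auto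
qed simp

lemma sph_modulus_eq_0_iff: "P x = 0 \<longleftrightarrow> (\<forall>i. T i x = 0)"
proof -
  have "P x = 0 \<longleftrightarrow> (norm (P x))\<^sup>2 = 0" by simp
  also have "\<dots> \<longleftrightarrow> (\<forall>i. T i x = 0)"
    unfolding norm_sph_modulus by (subst sum_nonneg_eq_0_iff) auto
  finally show ?thesis .
qed

text \<open>\<open>W\<close> is determined on the limit \<open>q\<close> by its values on the range
  of \<open>P\<close>, and it kills \<open>x - q\<close>. The sequence does not mention
  \<open>W\<close>, so this yields uniqueness of the polar factor.\<close>

lemma polar_factor_tendsto:
  assumes W: "bounded_linear W" "\<And>x. W (P x) = T i x" "\<And>x. P x = 0 \<Longrightarrow> W x = 0"
  shows "(\<lambda>n. T i (reg_inverse P n x)) \<longlonglongrightarrow> W x"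
proof -
  obtain q where q: "(\<lambda>n. P (reg_inverse P n x)) \<longlonglongrightarrow> q"
    using convergent_reg_inverse[OF positive_op_sph_modulus] convergent_def by blast
  have "W (x - q) = 0"
    by (rule W(3)[OF reg_inverse_limit_kernel[OF positive_op_sph_modulus q]])
  then have "W x = W q" by (simp add: linear_diff[OF bounded_linear.linear[OF W(1)]])
  then show ?thesis
    using bounded_linear.tendsto[OF W(1) q] by (simp add: W(2))
qed

lemma polar_exists:
  "\<exists>V. column_partial_isometry V \<and> (\<forall>i. T i = V i \<circ> P) \<and> (\<Inter>i. {x. V i x = 0}) = {x. P x = 0}"
proof -
  note P = positive_op_sph_modulus
  interpret P: bounded_linear P using P by (rule positive_op_imp_bounded_linear)
  have T_diff: "T i (x - y) = T i x - T i y" for i x y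
    by (rule linear_diff[OF bounded_linear.linear[OF bounded_clinear_imp_bounded_linear[OF T]]])
  have R: "bounded_clinear (reg_inverse P n)" for n by (rule bounded_clinear_reg_inverse[OF P])
  have R_0: "reg_inverse P n 0 = 0" for n
    by (rule linear_0[OF bounded_linear.linear[OF bounded_clinear_imp_bounded_linear[OF R]]])
  \<comment> \<open>Each \<open>T i\<close> is dominated in norm by \<open>P\<close>, so the Cauchy
    property transfers from \<open>P\<close> to \<open>T i\<close>.\<close>
  have "Cauchy (\<lambda>n. T i (reg_inverse P n x))" for i x
  proof (rule CauchyI)
    fix e :: real assume "0 < e"
    then obtain N where N: "\<And>m n. N \<le> m \<Longrightarrow> N \<le> n \<Longrightarrow>
        norm (P (reg_inverse P m x) - P (reg_inverse P n x)) < e"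
      using CauchyD[OF convergent_Cauchy[OF convergent_reg_inverse[OF P, of x]]] by blast
    have "norm (T i (reg_inverse P m x) - T i (reg_inverse P n x)) < e" if "N \<le> m" "N \<le> n" for m n
      using norm_le_norm_sph_modulus[of i "reg_inverse P m x - reg_inverse P n x"] N[OF that]
      by (simp add: T_diff P.diff)
    then show "\<exists>N. \<forall>m\<ge>N. \<forall>n\<ge>N. norm (T i (reg_inverse P m x) - T i (reg_inverse P n x)) < e"
      by blast
  qed
  then have "\<exists>y. (\<lambda>n. T i (reg_inverse P n x)) \<longlonglongrightarrow> y" for i x
    using Cauchy_convergent convergent_def by blast
  then obtain V where V: "\<And>i x. (\<lambda>n. T i (reg_inverse P n x)) \<longlonglongrightarrow> V i x" by metis
  have V_cl: "bounded_clinear (V i)" for i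
  proof (rule bounded_clinear_lim)
    show "bounded_clinear (\<lambda>x. T i (reg_inverse P n x))" for n
      using bounded_clinear_compose[OF T R] by (simp add: o_def)
    show "norm (T i (reg_inverse P n x)) \<le> 1 * norm x" for n x
      using order_trans[OF norm_le_norm_sph_modulus norm_reg_inverse_le[OF P]] by simp
  qed (rule V)
  have norm_V: "(\<lambda>n. (norm (P (reg_inverse P n x)))\<^sup>2) \<longlonglongrightarrow> (\<Sum>i\<in>UNIV. (norm (V i x))\<^sup>2)" for x
    unfolding norm_sph_modulus by (intro tendsto_sum tendsto_power tendsto_norm V)
  have VP: "V i (P x) = T i x" for i x
  proof -
    have "norm (T i (reg_inverse P n (P x)) - T i x) \<le> norm (P (reg_inverse P n (P x)) - P x)" for n
      using norm_le_norm_sph_modulus[of i "reg_inverse P n (P x) - x"] by (simp add: T_diff P.diff)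
    then have "\<forall>n. norm (T i (reg_inverse P n (P x)) - T i x) \<le> norm (P (reg_inverse P n (P x)) - P x)"
      by blast
    moreover have "(\<lambda>n. norm (P (reg_inverse P n (P x)) - P x)) \<longlonglongrightarrow> 0"
      by (intro tendsto_norm_zero LIM_zero reg_inverse_tendsto[OF P])
    ultimately have "(\<lambda>n. T i (reg_inverse P n (P x)) - T i x) \<longlonglongrightarrow> 0"
      by (rule Lim_null_comparison[OF always_eventually])
    from LIM_zero_cancel[OF this] show ?thesis using V LIMSEQ_unique by blast
  qed
  have ker: "(\<forall>i. V i x = 0) \<longleftrightarrow> P x = 0" for x
  proof
    assume "P x = 0"
    then have "P (reg_inverse P n x) = 0" for n
      by (simp add: R_0 flip: reg_inverse_commute[OF P])
    then have "T i (reg_inverse P n x) = 0" for i n using sph_modulus_eq_0_iff by blast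
    then show "\<forall>i. V i x = 0" using V[of _ x] by (simp add: LIMSEQ_const_iff)
  next
    \<comment> \<open>By \<open>norm_V\<close> the component of \<open>x\<close> coming from the
      range of \<open>P\<close> is zero, so all of \<open>x\<close> lies in the kernel.\<close>
    assume "\<forall>i. V i x = 0"
    then have "(\<lambda>n. (norm (P (reg_inverse P n x)))\<^sup>2) \<longlonglongrightarrow> 0" using norm_V[of x] by simp
    then have "(\<lambda>n. P (reg_inverse P n x)) \<longlonglongrightarrow> 0"
      by (simp add: tendsto_norm_zero_iff)
    from reg_inverse_limit_kernel[OF P this] show "P x = 0" by simp
  qed
  have "column_partial_isometry V"
    unfolding column_partial_isometry_def
  proof (intro conjI allI impI)
    fix x assume orth: "\<forall>y. (\<forall>i. V i y = 0) \<longrightarrow> cinner x y = 0"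
    obtain q where q: "(\<lambda>n. P (reg_inverse P n x)) \<longlonglongrightarrow> q"
      using convergent_reg_inverse[OF P] convergent_def by blast
    have k: "P (x - q) = 0" by (rule reg_inverse_limit_kernel[OF P q])
    then have "cinner x (x - q) = 0" using orth ker by blast
    \<comment> \<open>\<open>q\<close> is a limit of vectors in the range of the selfadjoint
      operator \<open>P\<close>, hence orthogonal to its kernel. Together with the assumption on
      \<open>x\<close> this gives \<open>x = q\<close>.\<close>
    moreover have "cinner q (x - q) = 0"
    proof -
      have "(\<lambda>n. cinner (P (reg_inverse P n x)) (x - q)) \<longlonglongrightarrow> cinner q (x - q)"
        by (intro cinner.tendsto q tendsto_const)
      then show ?thesis
        by (simp add: positive_op_selfadjoint[OF P] k cinner.zero_right LIMSEQ_const_iff)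
    qed
    ultimately have "cinner (x - q) (x - q) = 0" by (simp only: cinner.diff_left) simp
    then have "x = q" by (simp add: cinner_self)
    have "(\<lambda>n. (norm (P (reg_inverse P n x)))\<^sup>2) \<longlonglongrightarrow> (norm q)\<^sup>2"
      by (intro tendsto_power tendsto_norm q)
    with norm_V have "(\<Sum>i\<in>UNIV. (norm (V i x))\<^sup>2) = (norm x)\<^sup>2"
      unfolding \<open>x = q\<close> using LIMSEQ_unique by blast
    then show "sqrt (\<Sum>i\<in>UNIV. (norm (V i x))\<^sup>2) = norm x" by simp
  qed (rule V_cl)
  moreover have "\<forall>i. T i = V i \<circ> P" by (auto simp: VP)
  moreover have "(\<Inter>i. {x. V i x = 0}) = {x. P x = 0}" using ker by auto
  ultimately show ?thesis by blast
qed

lemma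
  shows bounded_clinear_sph_polar: "bounded_clinear (sph_polar T i)"
    and sph_polar_modulus: "sph_polar T i (P x) = T i x"
    and sph_polar_kernel: "(\<forall>i. sph_polar T i x = 0) \<longleftrightarrow> P x = 0"
proof -
  let ?P = "\<lambda>V. column_partial_isometry V \<and> (\<forall>i. T i = V i \<circ> P) \<and> (\<Inter>i. {x. V i x = 0}) = {x. P x = 0}"
  have lim: "(\<lambda>n. T i (reg_inverse P n x)) \<longlonglongrightarrow> V i x" if V: "?P V" for V i x
  proof (rule polar_factor_tendsto)
    show "bounded_linear (V i)"
      using V by (simp add: column_partial_isometry_def bounded_clinear_imp_bounded_linear)
    show "V i (P x) = T i x" for x using V by (metis comp_apply)
    show "V i x = 0" if "P x = 0" for x using V that by blast
  qed
  have "\<exists>!V. ?P V"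
  proof (rule ex_ex1I[OF polar_exists])
    fix V W assume "?P V" "?P W"
    from lim[OF this(1)] lim[OF this(2)] show "V = W"
      by (intro ext) (rule LIMSEQ_unique)
  qed
  from theI'[OF this] have V: "?P (sph_polar T)" unfolding sph_polar_def .
  then show "bounded_clinear (sph_polar T i)" by (simp add: column_partial_isometry_def)
  show "sph_polar T i (P x) = T i x" using V by (metis comp_apply)
  show "(\<forall>i. sph_polar T i x = 0) \<longleftrightarrow> P x = 0" using V by blast
qed

end

text \<open>On the range of \<open>P\<close> both sides reduce to products of \<open>T i\<close> and
  \<open>T j\<close>, which commute; on the kernel both vanish. Range and kernel together determine
  a bounded operator.\<close>

lemma sph_polar_criss_cross:
  assumes T: "commuting_tuple T"
  shows "sph_polar T i (sph_modulus T (sph_polar T j x)) = sph_polar T j (sph_modulus T (sph_polar T i x))"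
proof -
  have cl: "\<And>i. bounded_clinear (T i)" and comm: "\<And>i j x. T i (T j x) = T j (T i x)"
    using T unfolding commuting_tuple_def by (blast, metis comp_apply)
  note P = positive_op_sph_modulus[OF cl]
  let ?V = "sph_polar T" and ?P = "sph_modulus T"
  have V: "bounded_linear (?V i)" for i
    by (rule bounded_clinear_imp_bounded_linear[OF bounded_clinear_sph_polar[OF cl]])
  have lin: "bounded_linear (\<lambda>x. ?V i (?P (?V j x)))" for i j
    by (intro bounded_linear_compose[OF V] bounded_linear_compose[OF positive_op_imp_bounded_linear[OF P]] V)
  show ?thesis
  proof (rule eq_on_range_kernel[OF P lin lin])
    show "?V i (?P (?V j (?P x))) = ?V j (?P (?V i (?P x)))" for x
      by (simp add: sph_polar_modulus[OF cl] comm)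
    show "?V i (?P (?V j x)) = ?V j (?P (?V i x))" if "?P x = 0" for x
    proof -
      have "?V i x = 0" "?V j x = 0" using sph_polar_kernel[of T x, OF cl] that by blast+
      moreover have "?P 0 = 0"
        by (rule linear_0[OF bounded_linear.linear[OF positive_op_imp_bounded_linear[OF P]]])
      moreover have "?V k 0 = 0" for k by (rule linear_0[OF bounded_linear.linear[OF V]])
      ultimately show ?thesis by simp
    qed
  qed
qed

section \<open>Koszul complexes\<close>

text \<open>For \<open>i\<close> in \<open>J\<close>, this is the sign with which wedging by the
  \<open>i\<close>-th basis vector leads from \<open>J - {i}\<close> to \<open>J\<close>. Removing
  \<open>i\<close> does not change the count of elements below \<open>i\<close>.\<close>

definition koszul_sign :: "'d::linorder set \<Rightarrow> 'd \<Rightarrow> real" where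
  "koszul_sign J i = (- 1) ^ card {j \<in> J. j < i}"

lemma koszul_sign_mult_self [simp]: "koszul_sign J i * koszul_sign J i = 1"
  by (simp add: koszul_sign_def flip: power_add mult_2)

lemma koszul_sign_remove:
  fixes J :: "'d::{finite,linorder} set"
  assumes "k \<in> J"
  shows "koszul_sign (J - {k}) i = (if k < i then - koszul_sign J i else koszul_sign J i)"
proof (cases "k < i")
  case True
  have "{j \<in> J. j < i} = insert k {j \<in> J - {k}. j < i}" using True assms by auto
  then have "card {j \<in> J. j < i} = Suc (card {j \<in> J - {k}. j < i})" by simp
  then show ?thesis using True by (simp add: koszul_sign_def)
next
  case False
  then have "{j \<in> J - {k}. j < i} = {j \<in> J. j < i}" by auto
  then show ?thesis using False by (simp add: koszul_sign_def)
qed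

text \<open>For given \<open>i\<close> and \<open>J\<close>, only \<open>I = J - {i}\<close> with
  \<open>i\<close> in \<open>J\<close> contributes to the double sum.\<close>

lemma koszul_map_eq:
  "koszul_map T x J = (\<Sum>i\<in>J. koszul_sign J i *\<^sub>R T i (x (J - {i})))"
proof -
  have coeff: "wedge_coeff i I J = (if I = J - {i} then if i \<in> J then koszul_sign J i else 0 else 0)"
    for i I
  proof -
    have "i \<notin> I \<and> J = insert i I \<longleftrightarrow> I = J - {i} \<and> i \<in> J" by auto
    moreover have "{j \<in> J - {i}. j < i} = {j \<in> J. j < i}" by auto
    ultimately show ?thesis by (simp add: wedge_coeff_def koszul_sign_def)
  qed
  have "koszul_map T x J = (\<Sum>i\<in>UNIV. \<Sum>I\<in>UNIV. wedge_coeff i I J *\<^sub>R T i (x I))"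
    unfolding koszul_map_def by (rule sum.swap)
  also have "\<dots> = (\<Sum>i\<in>UNIV. \<Sum>I\<in>UNIV.
      if I = J - {i} then (if i \<in> J then koszul_sign J i *\<^sub>R T i (x I) else 0) else 0)"
    by (intro sum.cong refl) (simp add: coeff)
  also have "\<dots> = (\<Sum>i\<in>UNIV. if i \<in> J then koszul_sign J i *\<^sub>R T i (x (J - {i})) else 0)"
    by (simp only: sum.delta[OF finite] UNIV_I if_True)
  also have "\<dots> = (\<Sum>i\<in>J. koszul_sign J i *\<^sub>R T i (x (J - {i})))"
    by (simp add: sum.If_cases)
  finally show ?thesis .
qed

lemma koszul_map_in_koszul_space:
  fixes T :: "'d::{finite,linorder} \<Rightarrow> 'a::chilbert_space \<Rightarrow> 'a"
  assumes "\<And>i. linear (T i)" "x \<in> koszul_space k"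
  shows "koszul_map T x \<in> koszul_space (Suc k)"
  unfolding koszul_space_def
proof (intro CollectI allI impI)
  fix J :: "'d set" assume J: "card J \<noteq> Suc k"
  have "x (J - {i}) = 0" if "i \<in> J" for i
  proof -
    have "card (J - {i}) \<noteq> k"
      using J card_Suc_Diff1[of J i] that by auto
    then show ?thesis using assms(2) by (simp add: koszul_space_def)
  qed
  then show "koszul_map T x J = 0"
    unfolding koszul_map_eq by (intro sum.neutral ballI) (simp add: linear_0[OF assms(1)])
qed

lemma koszul_map_intertwine:
  assumes "linear S" "\<And>i x. S (T i x) = U i (S x)"
  shows "koszul_map U (\<lambda>I. S (x I)) = (\<lambda>J. S (koszul_map T x J))"
  by (rule ext) (simp add: koszul_map_eq linear_sum[OF assms(1)] linear_scale[OF assms(1)] assms(2))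

lemma koszul_space_map: "S 0 = 0 \<Longrightarrow> x \<in> koszul_space k \<Longrightarrow> (\<lambda>I. S (x I)) \<in> koszul_space k"
  by (simp add: koszul_space_def)

lemma koszul_space_diff:
  "x \<in> koszul_space k \<Longrightarrow> y \<in> koszul_space k \<Longrightarrow> (\<lambda>I. x I - y I) \<in> koszul_space k"
  by (simp add: koszul_space_def)

lemma koszul_map_diff:
  "(\<And>i. linear (T i)) \<Longrightarrow> koszul_map T (\<lambda>I. x I - y I) J = koszul_map T x J - koszul_map T y J"
  by (simp add: koszul_map_eq linear_diff scaleR_diff_right sum_subtractf)

lemma koszul_map_zero: "(\<And>i. linear (T i)) \<Longrightarrow> koszul_map T (\<lambda>I. 0) = (\<lambda>J. 0)"
  by (rule ext) (simp add: koszul_map_eq linear_0)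

text \<open>Removing \<open>i\<close> and \<open>k\<close> in the two possible orders produces
  opposite signs, so the double sum is antisymmetric and equals its own negative.\<close>

lemma koszul_map_koszul_map:
  assumes lin: "\<And>i. linear (T i)" and comm: "\<And>i j x. T i (T j x) = T j (T i x)"
  shows "koszul_map T (koszul_map T x) = (\<lambda>J. 0)"
proof
  fix J
  \<comment> \<open>Zero on the diagonal lets both indices run over all of \<open>J\<close>, so that
    the sums can be swapped.\<close>
  define F where "F = (\<lambda>i k. if i = k then 0
    else (koszul_sign J i * koszul_sign (J - {i}) k) *\<^sub>R T i (T k (x (J - {i} - {k}))))"
  let ?S = "\<Sum>i\<in>J. \<Sum>k\<in>J. F i k"
  have antisym: "F k i = - F i k" if "i \<in> J" "k \<in> J" for i k
  proof (cases "i = k")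
    case False
    have "koszul_sign J k * koszul_sign (J - {k}) i = - (koszul_sign J i * koszul_sign (J - {i}) k)"
      using False that by (auto simp: koszul_sign_remove)
    moreover have "J - {k} - {i} = J - {i} - {k}" by auto
    ultimately show ?thesis using False by (simp add: F_def comm[of k i])
  qed (simp add: F_def)
  have "koszul_map T (koszul_map T x) J
      = (\<Sum>i\<in>J. \<Sum>k\<in>J - {i}. (koszul_sign J i * koszul_sign (J - {i}) k) *\<^sub>R T i (T k (x (J - {i} - {k}))))"
    by (simp add: koszul_map_eq linear_sum[OF lin] linear_scale[OF lin] scaleR_sum_right)
  also have "\<dots> = ?S"
  proof (rule sum.cong[OF refl])
    fix i assume "i \<in> J"
    show "(\<Sum>k\<in>J - {i}. (koszul_sign J i * koszul_sign (J - {i}) k) *\<^sub>R T i (T k (x (J - {i} - {k}))))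
        = (\<Sum>k\<in>J. F i k)"
      by (rule sum.mono_neutral_cong_left) (auto simp: F_def)
  qed
  also have "?S = 0"
  proof -
    have "?S = (\<Sum>k\<in>J. \<Sum>i\<in>J. F i k)" by (rule sum.swap)
    also have "\<dots> = (\<Sum>k\<in>J. \<Sum>i\<in>J. - F k i)"
      by (intro sum.cong refl antisym)
    also have "\<dots> = - ?S" by (simp add: sum_negf)
    finally have "?S + ?S = 0" by (metis add.right_inverse)
    then have "2 *\<^sub>R ?S = 0" by (simp only: scaleR_2)
    then show ?thesis by simp
  qed
  finally show "koszul_map T (koszul_map T x) J = 0" .
qed

text \<open>Interior multiplication with the \<open>j\<close>-th dual basis vector, a homotopy between \<open>T\<^sub>j\<close> and \<open>0\<close>.\<close>

definition koszul_contract :: "'d::linorder \<Rightarrow> ('d set \<Rightarrow> 'a::real_vector) \<Rightarrow> 'd set \<Rightarrow> 'a" where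
  "koszul_contract j x I = (if j \<in> I then 0 else koszul_sign I j *\<^sub>R x (insert j I))"

lemma koszul_contract_in_koszul_space:
  fixes x :: "'d::{finite,linorder} set \<Rightarrow> 'a::chilbert_space"
  shows "x \<in> koszul_space (Suc k) \<Longrightarrow> koszul_contract j x \<in> koszul_space k"
  by (auto simp: koszul_space_def koszul_contract_def)

lemma koszul_contract_koszul_space_0:
  fixes x :: "'d::{finite,linorder} set \<Rightarrow> 'a::chilbert_space"
  shows "x \<in> koszul_space 0 \<Longrightarrow> koszul_contract j x = (\<lambda>I. 0)"
  by (rule ext) (auto simp: koszul_space_def koszul_contract_def)

lemma koszul_contract_zero: "koszul_contract j (\<lambda>I. 0) = (\<lambda>I. 0)"
  by (rule ext) (simp add: koszul_contract_def)

text \<open>For \<open>j\<close> in \<open>J\<close> the contraction of the image is zero, and only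
  \<open>i = j\<close> survives in the other term. For \<open>j\<close> outside \<open>J\<close> the
  summand \<open>i = j\<close> gives \<open>T j (x J)\<close>, and all others cancel by opposite
  signs.\<close>

lemma koszul_homotopy:
  assumes lin: "\<And>i. linear (T i)"
  shows "koszul_map T (koszul_contract j x) J + koszul_contract j (koszul_map T x) J = T j (x J)"
proof (cases "j \<in> J")
  case True
  have "koszul_map T (koszul_contract j x) J
      = (\<Sum>i\<in>J. if i = j then T j (x J) else 0)"
    unfolding koszul_map_eq
  proof (intro sum.cong refl)
    fix i assume "i \<in> J"
    show "koszul_sign J i *\<^sub>R T i (koszul_contract j x (J - {i})) = (if i = j then T j (x J) else 0)"
    proof (cases "i = j")
      case True
      then show ?thesis
        using \<open>j \<in> J\<close> by (simp add: koszul_contract_def linear_scale[OF lin] koszul_sign_remove insert_absorb)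
    next
      case False
      then show ?thesis using \<open>j \<in> J\<close> by (simp add: koszul_contract_def linear_0[OF lin])
    qed
  qed
  also have "\<dots> = T j (x J)" using True by (simp add: sum.delta)
  finally show ?thesis using True by (simp add: koszul_contract_def)
next
  case False
  have summand: "koszul_sign J i *\<^sub>R T i (koszul_contract j x (J - {i}))
      = - (koszul_sign J j *\<^sub>R (koszul_sign (insert j J) i *\<^sub>R T i (x (insert j J - {i}))))"
    if "i \<in> J" for i
  proof -
    have ij: "i \<noteq> j" using that False by auto
    have "koszul_sign J i = (if j < i then - koszul_sign (insert j J) i else koszul_sign (insert j J) i)"
      using koszul_sign_remove[of j "insert j J" i] False by simp
    then have "koszul_sign J i * koszul_sign (J - {i}) j = - (koszul_sign J j * koszul_sign (insert j J) i)"
      using ij that by (auto simp: koszul_sign_remove)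
    moreover have "insert j (J - {i}) = insert j J - {i}" using ij by auto
    ultimately show ?thesis
      using False by (simp add: koszul_contract_def linear_scale[OF lin])
  qed
  have "koszul_contract j (koszul_map T x) J
      = koszul_sign J j *\<^sub>R (\<Sum>i\<in>insert j J. koszul_sign (insert j J) i *\<^sub>R T i (x (insert j J - {i})))"
    using False by (simp add: koszul_contract_def koszul_map_eq)
  also have "\<dots> = (koszul_sign J j * koszul_sign (insert j J) j) *\<^sub>R T j (x J)
      + (\<Sum>i\<in>J. koszul_sign J j *\<^sub>R (koszul_sign (insert j J) i *\<^sub>R T i (x (insert j J - {i}))))"
    using False by (simp add: scaleR_add_right scaleR_sum_right)
  also have "koszul_sign (insert j J) j = koszul_sign J j"
    using koszul_sign_remove[of j "insert j J" j] False by simp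
  also have "(\<Sum>i\<in>J. koszul_sign J j *\<^sub>R (koszul_sign (insert j J) i *\<^sub>R T i (x (insert j J - {i}))))
      = - koszul_map T (koszul_contract j x) J"
    unfolding koszul_map_eq sum_negf[symmetric] by (intro sum.cong refl) (simp only: summand minus_minus)
  finally show ?thesis by simp
qed

text \<open>Boundaries are cocycles because the square of the Koszul map is zero, so exactness
  reduces to the triviality or solvability conditions.\<close>

lemma koszul_exact_iff:
  fixes T :: "'d::{finite,linorder} \<Rightarrow> 'a::chilbert_space \<Rightarrow> 'a"
  assumes lin: "\<And>i. linear (T i)" and comm: "\<And>i j x. T i (T j x) = T j (T i x)"
  shows "koszul_exact T \<longleftrightarrow>
    (\<forall>x\<in>koszul_space 0. koszul_map T x = (\<lambda>_. 0) \<longrightarrow> x = (\<lambda>_. 0)) \<and>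
    (\<forall>k<CARD('d). \<forall>x\<in>koszul_space (Suc k). koszul_map T x = (\<lambda>_. 0) \<longrightarrow>
       (\<exists>y\<in>koszul_space k. x = koszul_map T y))"
proof -
  have "{x \<in> koszul_space 0. koszul_map T x = (\<lambda>_. 0)} = {\<lambda>_. 0} \<longleftrightarrow>
      (\<forall>x\<in>koszul_space 0. koszul_map T x = (\<lambda>_. 0) \<longrightarrow> x = (\<lambda>_. 0))"
  proof -
    have "(\<lambda>_. 0) \<in> {x \<in> koszul_space 0. koszul_map T x = (\<lambda>_. 0)}"
      using koszul_map_zero[of T] lin by (simp add: koszul_space_def)
    then show ?thesis by blast
  qed
  moreover have "{x \<in> koszul_space (Suc k). koszul_map T x = (\<lambda>_. 0)} = koszul_map T ` koszul_space k \<longleftrightarrow>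
      (\<forall>x\<in>koszul_space (Suc k). koszul_map T x = (\<lambda>_. 0) \<longrightarrow> (\<exists>y\<in>koszul_space k. x = koszul_map T y))"
    for k
  proof -
    have "koszul_map T ` koszul_space k \<subseteq> {x \<in> koszul_space (Suc k). koszul_map T x = (\<lambda>_. 0)}"
      using koszul_map_in_koszul_space[of T, OF lin] koszul_map_koszul_map[of T, OF lin comm] by blast
    then show ?thesis by blast
  qed
  ultimately show ?thesis unfolding koszul_exact_def by simp
qed

text \<open>
  \<open>S\<close> and \<open>A\<close> induce maps between the cohomologies of the two Koszul complexes; since \<open>T\<^sub>j\<close> acts as
  \<open>0\<close> on the cohomology of \<open>T\<close>, the composite \<open>A S\<close> acts as the scalar \<open>l\<close>.
\<close>

lemma koszul_exact_transfer:
  fixes T U :: "'d::{finite,linorder} \<Rightarrow> 'a::chilbert_space \<Rightarrow> 'a"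
  assumes T: "\<And>i. bounded_clinear (T i)" "\<And>i j x. T i (T j x) = T j (T i x)"
    and U: "\<And>i. linear (U i)" "\<And>i j x. U i (U j x) = U j (U i x)"
    and S: "linear S" "\<And>i x. S (T i x) = U i (S x)"
    and A: "linear A" "\<And>i x. A (U i x) = T i (A x)"
    and AS: "\<And>x. A (S x) = T j x + l *\<^sub>C x" and "l \<noteq> 0"
    and exact: "koszul_exact U"
  shows "koszul_exact T"
proof -
  have lin: "linear (T i)" for i
    by (intro bounded_linear.linear bounded_clinear_imp_bounded_linear T)
  note U_exact = exact[unfolded koszul_exact_iff[OF U]]
  have S_ker: "koszul_map U (\<lambda>I. S (x I)) = (\<lambda>_. 0)" if "koszul_map T x = (\<lambda>_. 0)" for x
    unfolding koszul_map_intertwine[of S T U, OF S] that by (simp add: linear_0[OF S(1)])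
  have T_j: "T j (x I) = koszul_map T (koszul_contract j x) I" if "koszul_map T x = (\<lambda>_. 0)" for x I
    using koszul_homotopy[of T j x I] lin that by (simp add: koszul_contract_zero)
  show ?thesis
    unfolding koszul_exact_iff[OF lin T(2)]
  proof (intro conjI ballI impI allI)
    fix x :: "'d set \<Rightarrow> 'a" assume x: "x \<in> koszul_space 0" "koszul_map T x = (\<lambda>_. 0)"
    have "(\<lambda>I. S (x I)) = (\<lambda>_. 0)"
      using U_exact S_ker[OF x(2)] koszul_space_map[of S x 0] x(1) linear_0[OF S(1)] by blast
    then have "S (x I) = 0" for I by (rule fun_cong)
    then have "l *\<^sub>C x I = 0" for I
      using AS[of "x I"] T_j[OF x(2), of I] koszul_contract_koszul_space_0[OF x(1)] koszul_map_zero[of T] lin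
      by (simp add: linear_0[OF A(1)])
    then show "x = (\<lambda>_. 0)" using \<open>l \<noteq> 0\<close> by (auto simp: complex_vector.scale_eq_0_iff)
  next
    fix k and x :: "'d set \<Rightarrow> 'a"
    assume k: "k < CARD('d)" and x: "x \<in> koszul_space (Suc k)" "koszul_map T x = (\<lambda>_. 0)"
    obtain y where y: "y \<in> koszul_space k" "(\<lambda>I. S (x I)) = koszul_map U y"
      using U_exact k S_ker[OF x(2)] koszul_space_map[of S x "Suc k"] x(1) linear_0[OF S(1)] by blast
    \<comment> \<open>The boundary of \<open>A (y I)\<close> is \<open>A (S (x I))\<close>, that is
      \<open>T j (x I) + l *\<^sub>C x I\<close>. Subtracting the homotopy term removes
      \<open>T j (x I)\<close> and leaves \<open>l\<close> times the given cocycle.\<close>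
    define z where "z = (\<lambda>I. A (y I) - koszul_contract j x I)"
    have z: "z \<in> koszul_space k"
      unfolding z_def
      by (rule koszul_space_diff[OF koszul_space_map[of A, OF linear_0[OF A(1)] y(1)]
            koszul_contract_in_koszul_space[OF x(1)]])
    have "koszul_map T z I = l *\<^sub>C x I" for I
    proof -
      have "S (x I) = koszul_map U y I" using fun_cong[OF y(2)] .
      then have "A (S (x I)) = koszul_map T (\<lambda>I. A (y I)) I"
        by (simp add: koszul_map_intertwine[of A U T, OF A])
      then show ?thesis
        using AS[of "x I"] T_j[OF x(2), of I] by (simp add: z_def koszul_map_diff[of T, OF lin]) (metis add_diff_cancel_left')
    qed
    then have "x I = (1 / l) *\<^sub>C koszul_map T z I" for I
      using \<open>l \<noteq> 0\<close> by (simp add: scaleC_scaleC scaleC_one)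
    moreover have "koszul_map T (\<lambda>I. (1 / l) *\<^sub>C z I) = (\<lambda>J. (1 / l) *\<^sub>C koszul_map T z J)"
      by (rule koszul_map_intertwine)
        (auto simp: bounded_clinear_scaleC[OF T(1)] bounded_linear.linear[OF bounded_linear_scaleC])
    ultimately have "x = koszul_map T (\<lambda>I. (1 / l) *\<^sub>C z I)" by (intro ext) simp
    moreover have "(\<lambda>I. (1 / l) *\<^sub>C z I) \<in> koszul_space k"
      by (rule koszul_space_map[of "\<lambda>y. (1 / l) *\<^sub>C y", OF _ z]) simp
    ultimately show "\<exists>y\<in>koszul_space k. x = koszul_map T y" by blast
  qed
qed

section \<open>Exactness under similarity\<close>

lemma linear_inv:
  fixes S :: "'a::real_vector \<Rightarrow> 'b::real_vector"
  assumes "linear S" "bij S"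
  shows "linear (inv S)"
proof (rule linearI)
  have inv: "inv S (S x) = x" "S (inv S y) = y" for x y
    using assms(2) by (simp_all add: bij_is_inj bij_is_surj surj_f_inv_f)
  show "inv S (x + y) = inv S x + inv S y" for x y
    by (metis inv linear_add[OF assms(1)])
  show "inv S (r *\<^sub>R x) = r *\<^sub>R inv S x" for r x
    by (metis inv linear_scale[OF assms(1)])
qed

text \<open>Exactness is an algebraic condition: a cocycle is transported by \<open>S\<close>,
  solved for in the complex of \<open>U\<close>, and the solution brought back by the
  inverse.\<close>

lemma koszul_exact_similar:
  fixes T U :: "'d::{finite,linorder} \<Rightarrow> 'a::chilbert_space \<Rightarrow> 'a"
  assumes T: "\<And>i. linear (T i)" "\<And>i j x. T i (T j x) = T j (T i x)"
    and U: "\<And>i. linear (U i)" "\<And>i j x. U i (U j x) = U j (U i x)"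
    and S: "linear S" "bij S" "\<And>i x. S (T i x) = U i (S x)"
    and exact: "koszul_exact U"
  shows "koszul_exact T"
proof -
  define R where "R = inv S"
  have RS: "R (S x) = x" and SR: "S (R x) = x" for x
    using S(2) by (simp_all add: R_def bij_is_inj bij_is_surj surj_f_inv_f)
  have R: "linear R" unfolding R_def by (rule linear_inv[OF S(1,2)])
  have RU: "R (U i x) = T i (R x)" for i x
    using S(3)[of i "R x"] by (metis RS SR)
  note U_exact = exact[unfolded koszul_exact_iff[OF U]]
  have S_ker: "koszul_map U (\<lambda>I. S (x I)) = (\<lambda>_. 0)" if "koszul_map T x = (\<lambda>_. 0)" for x
    unfolding koszul_map_intertwine[of S T U, OF S(1,3)] that by (simp add: linear_0[OF S(1)])
  show ?thesis
    unfolding koszul_exact_iff[OF T]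
  proof (intro conjI ballI impI allI)
    fix x :: "'d set \<Rightarrow> 'a" assume x: "x \<in> koszul_space 0" "koszul_map T x = (\<lambda>_. 0)"
    have "(\<lambda>I. S (x I)) = (\<lambda>_. 0)"
      using U_exact S_ker[OF x(2)] koszul_space_map[of S x 0] x(1) linear_0[OF S(1)] by blast
    then have "S (x I) = 0" for I by (rule fun_cong)
    then show "x = (\<lambda>_. 0)" by (intro ext) (metis RS linear_0[OF R])
  next
    fix k and x :: "'d set \<Rightarrow> 'a"
    assume k: "k < CARD('d)" and x: "x \<in> koszul_space (Suc k)" "koszul_map T x = (\<lambda>_. 0)"
    obtain y where y: "y \<in> koszul_space k" "(\<lambda>I. S (x I)) = koszul_map U y"
      using U_exact k S_ker[OF x(2)] koszul_space_map[of S x "Suc k"] x(1) linear_0[OF S(1)] by blast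
    have "x I = koszul_map T (\<lambda>I. R (y I)) I" for I
    proof -
      have "x I = R (S (x I))" by (simp only: RS)
      also have "S (x I) = koszul_map U y I" using fun_cong[OF y(2)] .
      also have "R (koszul_map U y I) = koszul_map T (\<lambda>I. R (y I)) I"
        by (simp only: koszul_map_intertwine[of R U T, OF R RU])
      finally show ?thesis .
    qed
    then have "x = koszul_map T (\<lambda>I. R (y I))" by blast
    moreover have "(\<lambda>I. R (y I)) \<in> koszul_space k"
      by (rule koszul_space_map[of R, OF linear_0[OF R] y(1)])
    ultimately show "\<exists>y\<in>koszul_space k. x = koszul_map T y" by blast
  qed
qed

section \<open>The spectrum of the spherical Aluthge transform\<close>

text \<open>Every vector, placed in top degree, is a cocycle. Exactness there makes it a sum of
  values of the \<open>U i\<close>, all of which lie in the range of \<open>S\<close>.\<close>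

lemma koszul_exact_imp_surj:
  fixes U :: "'d::{finite,linorder} \<Rightarrow> 'a::chilbert_space \<Rightarrow> 'a"
  assumes U: "\<And>i. linear (U i)" "\<And>i j x. U i (U j x) = U j (U i x)"
    and S: "linear S" "\<And>i x. U i x = S (A i x)"
    and exact: "koszul_exact U"
  shows "surj S"
proof -
  have "\<exists>z. y = S z" for y
  proof -
    define x where "x = (\<lambda>I :: 'd set. if I = UNIV then y else 0)"
    obtain k where k: "CARD('d) = Suc k"
      using not0_implies_Suc[of "CARD('d)"] by auto
    have x: "x \<in> koszul_space (Suc k)"
      using k by (auto simp: koszul_space_def x_def)
    have "koszul_map U x J = 0" for J
    proof -
      have "x (J - {i}) = 0" if "i \<in> J" for i using that by (auto simp: x_def)
      then show ?thesis unfolding koszul_map_eq by (intro sum.neutral ballI) (simp add: linear_0[OF U(1)])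
    qed
    then have "koszul_map U x = (\<lambda>_. 0)" by (rule ext)
    moreover have "k < CARD('d)" using k by simp
    ultimately obtain w where "x = koszul_map U w"
      using exact[unfolded koszul_exact_iff[OF U]] x by blast
    then have "y = koszul_map U w UNIV" by (metis x_def)
    also have "\<dots> = S (\<Sum>i\<in>UNIV. koszul_sign UNIV i *\<^sub>R A i (w (UNIV - {i})))"
      by (simp add: koszul_map_eq S(2) linear_sum[OF S(1)] linear_scale[OF S(1)])
    finally show ?thesis by blast
  qed
  then show ?thesis by blast
qed

lemma koszul_exact_imp_bij_modulus:
  fixes T :: "'d::{finite,linorder} \<Rightarrow> 'a::chilbert_space \<Rightarrow> 'a"
  assumes comm: "commuting_tuple T" and exact: "koszul_exact T"
  shows "bij (sph_modulus T)"
proof -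
  let ?V = "sph_polar T" and ?P = "sph_modulus T"
  have cl: "\<And>i. bounded_clinear (T i)" and commutes: "\<And>i j x. T i (T j x) = T j (T i x)"
    using comm unfolding commuting_tuple_def by (blast, metis comp_apply)
  have lin: "linear (T i)" for i
    by (intro bounded_linear.linear bounded_clinear_imp_bounded_linear cl)
  have V_lin: "linear (?V i)" for i
    by (intro bounded_linear.linear bounded_clinear_imp_bounded_linear bounded_clinear_sph_polar cl)
  have P_lin: "linear ?P"
    by (intro bounded_linear.linear positive_op_imp_bounded_linear positive_op_sph_modulus cl)
  note VP = sph_polar_modulus[of T, OF cl]
  note T_exact = exact[unfolded koszul_exact_iff[OF lin commutes]]
  have ker: "w = 0" if "?P w = 0" for w
  proof -
    define x where "x = (\<lambda>I :: 'd set. if I = {} then w else 0)"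
    have "T i w = 0" for i using that sph_modulus_eq_0_iff[of T w, OF cl] by blast
    then have "T i (x I) = 0" for i I by (simp add: x_def linear_0[OF lin])
    then have "koszul_map T x = (\<lambda>_. 0)"
      by (intro ext) (simp add: koszul_map_eq)
    moreover have "x \<in> koszul_space 0" by (simp add: koszul_space_def x_def)
    ultimately have "x = (\<lambda>_. 0)" using T_exact by blast
    then show ?thesis by (metis x_def)
  qed
  have "\<exists>w. y = ?P w" for y
  proof -
    \<comment> \<open>This is the degree-one cochain with value \<open>?V i y\<close> at
      \<open>{i}\<close>; \<open>the_elem\<close> recovers the index from the singleton.\<close>
    define x where "x = (\<lambda>I :: 'd set. if card I = 1 then ?V (the_elem I) y else 0)"
    have "x \<in> koszul_space (Suc 0)" by (simp add: koszul_space_def x_def)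
    moreover have "koszul_map T x J = 0" for J
    proof (cases "card J = 2")
      case True
      then obtain a b where ab: "J = {a, b}" "a \<noteq> b" by (auto simp: card_2_iff)
      have *: "koszul_sign {a, b} a = - koszul_sign {a, b} b"
      proof (cases "a < b")
        case True
        then have "{j \<in> {a, b}. j < a} = {}" "{j \<in> {a, b}. j < b} = {a}" by auto
        then show ?thesis unfolding koszul_sign_def by (simp only:) simp
      next
        case False
        then have "{j \<in> {a, b}. j < a} = {b}" "{j \<in> {a, b}. j < b} = {}" using ab by auto
        then show ?thesis unfolding koszul_sign_def by (simp only:) simp
      qed
      have sets: "{a, b} - {a} = {b}" "{a, b} - {b} = {a}" using ab by auto
      have "koszul_map T x J = koszul_sign {a, b} b *\<^sub>R (T b (?V a y) - T a (?V b y))"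
        unfolding koszul_map_eq ab(1) using ab(2)
        by (simp add: sets x_def * scaleR_diff_right)
      \<comment> \<open>Writing \<open>T\<close> as \<open>?V\<close> after \<open>?P\<close> makes
        the cocycle condition the criss-cross identity of the polar factors.\<close>
      also have "T b (?V a y) - T a (?V b y) = 0"
        using sph_polar_criss_cross[OF comm, of b a y] by (simp only: VP right_minus_eq)
      finally show ?thesis by simp
    next
      case False
      have "x (J - {i}) = 0" if "i \<in> J" for i
      proof -
        have "Suc (card (J - {i})) = card J" using that by (intro card_Suc_Diff1) simp_all
        then show ?thesis using False by (simp add: x_def)
      qed
      then show ?thesis unfolding koszul_map_eq by (intro sum.neutral ballI) (simp add: linear_0[OF lin])
    qed
    then have "koszul_map T x = (\<lambda>_. 0)" by (rule ext)
    ultimately obtain z where z: "x = koszul_map T z"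
      using T_exact zero_less_card_finite by blast
    \<comment> \<open>At \<open>{j}\<close> the boundary of \<open>z\<close> is
      \<open>T j (z {})\<close>, that is \<open>?V j (?P (z {}))\<close>. The whole column thus
      kills the difference, which therefore lies in the trivial kernel of \<open>?P\<close>.\<close>
    have "?V j (y - ?P (z {})) = 0" for j
    proof -
      have "?V j y = koszul_map T z {j}" using fun_cong[OF z, of "{j}"] by (simp add: x_def)
      also have "\<dots> = T j (z {})"
      proof -
        have "{i \<in> {j}. i < j} = {}" by auto
        then have "koszul_sign {j} j = 1" unfolding koszul_sign_def by (simp only:) simp
        then show ?thesis by (simp add: koszul_map_eq)
      qed
      finally show ?thesis by (simp add: linear_diff[OF V_lin] VP)
    qed
    then have "?P (y - ?P (z {})) = 0" using sph_polar_kernel[of T "y - ?P (z {})", OF cl] by blast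
    then show ?thesis using ker by (metis eq_iff_diff_eq_0)
  qed
  then have "surj ?P" by blast
  moreover have "inj ?P" using ker by (simp add: linear_injective_0[OF P_lin])
  ultimately show ?thesis by (simp add: bij_def)
qed

text \<open>The kernel of a selfadjoint map is orthogonal to its range, which here is the whole
  space.\<close>

lemma selfadjoint_surj_imp_inj:
  fixes S :: "'a::chilbert_space \<Rightarrow> 'a"
  assumes "linear S" "\<And>x y. cinner (S x) y = cinner x (S y)" "surj S"
  shows "inj S"
  unfolding linear_injective_0[OF assms(1)]
proof (intro allI impI)
  fix x assume "S x = 0"
  then have "cinner x (S y) = 0" for y by (simp add: cinner.zero_left flip: assms(2))
  then have "cinner x x = 0" using assms(3) by (metis surjD)
  then show "x = 0" by (simp add: cinner_self)
qed

lemma bounded_clinear_shift: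
  assumes "bounded_clinear A"
  shows "bounded_clinear (\<lambda>x. A x - l *\<^sub>C x)"
  using assms unfolding bounded_clinear_def
  by (auto intro!: bounded_linear_sub bounded_linear_scaleC
      simp: complex_vector.scale_right_diff_distrib scaleC_scaleC mult.commute)

lemma taylor_spectrum_sph_aluthge:
  fixes T :: "'d::{finite,linorder} \<Rightarrow> 'a::chilbert_space \<Rightarrow> 'a" and t :: real
  assumes comm: "commuting_tuple T" and t: "0 < t" "t \<le> 1"
  shows "taylor_spectrum (sph_aluthge t T) = taylor_spectrum T"
proof -
  have cl: "\<And>i. bounded_clinear (T i)" and T_comm: "\<And>i j x. T i (T j x) = T j (T i x)"
    using comm unfolding commuting_tuple_def by (blast, metis comp_apply)
  define P where "P = sph_modulus T"
  define S where "S = op_powr P t"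
  define R where "R = op_powr P (1 - t)"
  define A where "A = (\<lambda>i x. sph_polar T i (R x))"
  define U where "U = sph_aluthge t T"
  have P: "positive_op P" unfolding P_def by (rule positive_op_sph_modulus[OF cl])
  have U_eq: "U i x = S (A i x)" for i x
    by (simp add: U_def sph_aluthge_def S_def R_def A_def P_def)
  \<comment> \<open>The exponents \<open>t\<close> and \<open>1 - t\<close> are both nonnegative and
    add up to 1.\<close>
  have SR: "S (R x) = P x" and RS: "R (S x) = P x" for x
    using t P by (simp_all add: S_def R_def op_powr_add op_powr_1)
  have T_eq: "T i x = A i (S x)" for i x
    by (simp add: A_def RS) (simp add: P_def sph_polar_modulus[OF cl])
  have S_cl: "bounded_clinear S" and R_cl: "bounded_clinear R"
    using t by (simp_all add: S_def R_def bounded_clinear_op_powr[OF P])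
  have A_cl: "bounded_clinear (A i)" for i
    using bounded_clinear_compose[OF bounded_clinear_sph_polar[of T i, OF cl] R_cl]
    by (simp add: A_def o_def)
  have U_cl: "bounded_clinear (U i)" for i
    using bounded_clinear_compose[OF S_cl A_cl[of i]] by (simp add: U_eq[abs_def] o_def)
  \<comment> \<open>Between the two polar factors stands \<open>R\<close> after \<open>S\<close>,
    which is \<open>P\<close>.\<close>
  have criss_cross: "A i (S (A j x)) = A j (S (A i x))" for i j x
    by (simp add: A_def RS) (simp add: P_def sph_polar_criss_cross[OF comm])
  have lin: "bounded_clinear B \<Longrightarrow> linear B" for B :: "'a \<Rightarrow> 'a"
    by (intro bounded_linear.linear bounded_clinear_imp_bounded_linear)
  have "koszul_exact (\<lambda>i x. U i x - (l $ i) *\<^sub>C x) \<longleftrightarrow> koszul_exact (\<lambda>i x. T i x - (l $ i) *\<^sub>C x)" for l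
  proof -
    let ?T = "\<lambda>i x. T i x - (l $ i) *\<^sub>C x" and ?U = "\<lambda>i x. U i x - (l $ i) *\<^sub>C x"
    have T_cl': "bounded_clinear (?T i)" and U_cl': "bounded_clinear (?U i)" for i
      by (rule bounded_clinear_shift[OF cl], rule bounded_clinear_shift[OF U_cl])
    note scale = complex_vector.scale_right_diff_distrib
    have T_comm': "?T i (?T j x) = ?T j (?T i x)" for i j x
      by (simp add: linear_diff[OF lin[OF cl]] bounded_clinear_scaleC[OF cl] scale scaleC_scaleC
          T_comm[of i j] mult.commute[of "l $ i"])
    have U_comm: "U i (U j x) = U j (U i x)" for i j x
      by (simp add: U_eq criss_cross[of i j])
    have U_comm': "?U i (?U j x) = ?U j (?U i x)" for i j x
      by (simp add: linear_diff[OF lin[OF U_cl]] bounded_clinear_scaleC[OF U_cl] scale scaleC_scaleC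
          U_comm[of i j] mult.commute[of "l $ i"])
    have S_inter: "S (?T i x) = ?U i (S x)" for i x
      by (simp add: linear_diff[OF lin[OF S_cl]] bounded_clinear_scaleC[OF S_cl] T_eq U_eq)
    have A_inter: "A j (?U i x) = ?T i (A j x)" for i j x
      by (simp add: linear_diff[OF lin[OF A_cl]] bounded_clinear_scaleC[OF A_cl] T_eq U_eq criss_cross[of j i])
    show ?thesis
    proof (cases "l = 0")
      case False
      \<comment> \<open>One nonzero coordinate of \<open>l\<close> suffices: it selects the map
        \<open>A j\<close> used against \<open>S\<close> in both directions.\<close>
      then obtain j where j: "l $ j \<noteq> 0" by (auto simp: vec_eq_iff)
      have "A j (S x) = ?T j x + (l $ j) *\<^sub>C x" for x by (simp add: T_eq)
      then have "koszul_exact ?T" if "koszul_exact ?U"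
        using koszul_exact_transfer[of ?T ?U S "A j" j "l $ j", OF T_cl' T_comm' lin[OF U_cl'] U_comm'
            lin[OF S_cl] S_inter lin[OF A_cl] A_inter _ j that] by blast
      moreover have "S (A j x) = ?U j x + (l $ j) *\<^sub>C x" for x by (simp add: U_eq)
      then have "koszul_exact ?U" if "koszul_exact ?T"
        using koszul_exact_transfer[of ?U ?T "A j" S j "l $ j", OF U_cl' U_comm' lin[OF T_cl'] T_comm'
            lin[OF A_cl] A_inter lin[OF S_cl] S_inter _ j that] by blast
      ultimately show ?thesis by blast
    next
      case True
      have T0: "?T = T" and U0: "?U = U" by (simp_all add: True)
      have S_inter0: "S (T i x) = U i (S x)" for i x by (simp add: T_eq U_eq)
      have S_bij: "bij S" if "koszul_exact T \<or> koszul_exact U"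
        using that
      proof
        assume "koszul_exact T"
        then have "bij P" unfolding P_def by (rule koszul_exact_imp_bij_modulus[OF comm])
        \<comment> \<open>The factorization of \<open>P\<close> with \<open>S\<close> on the left
          gives surjectivity, and the one with \<open>S\<close> on the right gives
          injectivity.\<close>
        have "surj S" by (metis SR \<open>bij P\<close> bij_is_surj surj_def)
        moreover have "inj S" by (metis RS \<open>bij P\<close> bij_is_inj injD injI)
        ultimately show ?thesis by (simp add: bij_def)
      next
        assume "koszul_exact U"
        then have "surj S"
          using koszul_exact_imp_surj[of U S A, OF lin[OF U_cl] U_comm lin[OF S_cl] U_eq] by blast
        moreover have "inj S"
          using selfadjoint_surj_imp_inj[OF lin[OF S_cl] _ \<open>surj S\<close>] op_powr_selfadjoint[OF P] t
          by (simp add: S_def)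
        ultimately show ?thesis by (simp add: bij_def)
      qed
      \<comment> \<open>The converse implication applies the similarity lemma to the inverse of
        \<open>S\<close>.\<close>
      define S' where "S' = inv S"
      have "koszul_exact T" if "koszul_exact U"
        using koszul_exact_similar[of T U S, OF lin[OF cl] T_comm lin[OF U_cl] U_comm lin[OF S_cl] _ S_inter0 that]
          S_bij that by blast
      moreover have "koszul_exact U" if "koszul_exact T"
      proof -
        have "bij S" using S_bij that by blast
        then have S'S: "S' (S x) = x" and SS': "S (S' x) = x" for x
          by (simp_all add: S'_def bij_is_inj bij_is_surj surj_f_inv_f)
        have "linear S'" unfolding S'_def by (rule linear_inv[OF lin[OF S_cl] \<open>bij S\<close>])
        moreover have "bij S'" unfolding S'_def by (rule bij_imp_bij_inv[OF \<open>bij S\<close>])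
        moreover have "S' (U i x) = T i (S' x)" for i x
          by (metis S_inter0 S'S SS')
        ultimately show ?thesis
          using koszul_exact_similar[of U T S', OF lin[OF U_cl] U_comm lin[OF cl] T_comm _ _ _ that]
          by blast
      qed
      ultimately show ?thesis unfolding T0 U0 by blast
    qed
  qed
  then show ?thesis unfolding taylor_spectrum_def U_def[symmetric] by simp
qed

theorem theorem1p1:
  fixes T :: "'d::{finite,linorder} \<Rightarrow> 'a::chilbert_space \<Rightarrow> 'a" and t :: real
  assumes infinite_dim: "\<not> (\<exists>B :: 'a set. finite B \<and> complex_vector.span B = UNIV)"
    and commuting: "commuting_tuple T"
    and t: "0 < t" "t \<le> 1"
  shows "taylor_spectrum (sph_aluthge t T) = taylor_spectrum T \<and>
    joint_spectral_radius (sph_aluthge t T) = joint_spectral_radius T"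
  using taylor_spectrum_sph_aluthge[OF commuting t] by (simp add: joint_spectral_radius_def)

end
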